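(* Let $V$ be a finite set of points in the plane, with $Y_4$ and $Del^\infty$ as in the context. For each edge $(a,b)\in Del^\infty$, \[ d_{Y_4}(a,b)\le (11+7\sqrt{2})\, d_2(a,b). \]
   Context: $d_2$ denotes Euclidean distance. At each $u\in V$ the two axis-parallel lines through $u$ define four quadrants (cones of angle $\pi/2$) $Q_1(u),\dots,Q_4(u)$, labeled counterclockwise starting with the first quadrant; each cone includes its clockwise bounding ray and excludes its counterclockwise bounding ray. The directed Yao graph $\overrightarrow{Y_4}$ contains, for each $u\in V$ and each cone $Q_i(u)$ containing a point of $V\setminus\{u\}$, a directed edge from $u$ to a vertex $v\in Q_i(u)$ minimizing $d_2(u,v)$ (ties broken arbitrarily); $Y_4$ is the undirected version. $Del^\infty$ is the $L_\infty$-Delaunay triangulation of $V$: $(u,v)$ is an edge iff there is an axis-aligned square with $u$ and $v$ on its boundary and no vertex of $V$ in its interior. Edge weights are Euclidean lengths, path length is the sum of weights, and $d_{Y_4}(u,v)$ is the length of a shortest path in $Y_4$ between $u$ and $v$. *)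

theory Defs
  imports "HOL-Analysis.Analysis" "HOL-Library.Extended_Real"
begin

type_synonym point = "real \<times> real"

text \<open>Quadrant cones Q_1..Q_4 at u, counterclockwise from the first quadrant;
  each includes its clockwise bounding ray and excludes its counterclockwise one.\<close>
definition quadrant :: "nat \<Rightarrow> point \<Rightarrow> point set" where
  "quadrant i u = {v. let dx = fst v - fst u; dy = snd v - snd u in
     (i = 1 \<and> dx > 0 \<and> dy \<ge> 0) \<or>
     (i = 2 \<and> dx \<le> 0 \<and> dy > 0) \<or>
     (i = 3 \<and> dx < 0 \<and> dy \<le> 0) \<or>
     (i = 4 \<and> dx \<ge> 0 \<and> dy < 0)}"

text \<open>A valid choice of Yao edges (ties broken arbitrarily): f u i is a Euclidean-nearest
  point of V - {u} in cone Q_i(u), whenever that cone contains such a point.\<close>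
definition yao_choice :: "point set \<Rightarrow> (point \<Rightarrow> nat \<Rightarrow> point) \<Rightarrow> bool" where
  "yao_choice V f \<longleftrightarrow> (\<forall>u\<in>V. \<forall>i\<in>{1..4}.
     (\<exists>v\<in>V - {u}. v \<in> quadrant i u) \<longrightarrow>
       (f u i \<in> V - {u} \<and> f u i \<in> quadrant i u \<and>
        (\<forall>w\<in>V - {u}. w \<in> quadrant i u \<longrightarrow> dist u (f u i) \<le> dist u w)))"

definition yao4_dir :: "point set \<Rightarrow> (point \<Rightarrow> nat \<Rightarrow> point) \<Rightarrow> point \<Rightarrow> point \<Rightarrow> bool" where
  "yao4_dir V f u v \<longleftrightarrow> u \<in> V \<and> (\<exists>i\<in>{1..4}. (\<exists>w\<in>V - {u}. w \<in> quadrant i u) \<and> v = f u i)"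

definition yao4 :: "point set \<Rightarrow> (point \<Rightarrow> nat \<Rightarrow> point) \<Rightarrow> point \<Rightarrow> point \<Rightarrow> bool" where
  "yao4 V f u v \<longleftrightarrow> yao4_dir V f u v \<or> yao4_dir V f v u"

definition is_walk :: "(point \<Rightarrow> point \<Rightarrow> bool) \<Rightarrow> point list \<Rightarrow> point \<Rightarrow> point \<Rightarrow> bool" where
  "is_walk E ps a b \<longleftrightarrow> ps \<noteq> [] \<and> hd ps = a \<and> last ps = b \<and>
     (\<forall>k. Suc k < length ps \<longrightarrow> E (ps ! k) (ps ! Suc k))"

definition walk_length :: "point list \<Rightarrow> real" where
  "walk_length ps = (\<Sum>k<length ps - 1. dist (ps ! k) (ps ! Suc k))"

text \<open>Shortest-path distance in Y_4 (infinite if no path).\<close>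
definition d_yao4 :: "point set \<Rightarrow> (point \<Rightarrow> nat \<Rightarrow> point) \<Rightarrow> point \<Rightarrow> point \<Rightarrow> ereal" where
  "d_yao4 V f a b = (INF ps \<in> {ps. is_walk (yao4 V f) ps a b}. ereal (walk_length ps))"

text \<open>L_infinity Delaunay edge: an axis-aligned square (centre c, half-side r) with
  a and b on its boundary and no point of V in its interior.\<close>
definition linf :: "point \<Rightarrow> point \<Rightarrow> real" where
  "linf c p = max \<bar>fst p - fst c\<bar> \<bar>snd p - snd c\<bar>"

definition del_inf :: "point set \<Rightarrow> point \<Rightarrow> point \<Rightarrow> bool" where
  "del_inf V a b \<longleftrightarrow> a \<in> V \<and> b \<in> V \<and> a \<noteq> b \<and>
     (\<exists>c r. r > 0 \<and> linf c a = r \<and> linf c b = r \<and> (\<forall>v\<in>V. \<not> linf c v < r))"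

end

theory Submission
  imports Defs
begin

text \<open>
  From \<open>p\<close> and \<open>q\<close> follow Yao edges towards the other point inside the box they span. Unless the paths
  meet, they leave the box, and if they leave through suitable sides then an edge \<open>x \<rightarrow> y\<close> of one
  intersects an edge \<open>u \<rightarrow> v\<close> of the other. The quadrilateral of the four endpoints has a side joining
  the two edges that is shorter than \<open>dist p q\<close> by a constant factor. The empty sectors of the
  two edges either force the next pair of paths to leave its box through suitable sides again or
  produce an intersection of Yao edges in adjacent directions, with an even shorter side; so
  an induction on distance gives a walk of length at most \<open>25/4 * dist p q\<close>.

  For a Delaunay edge, shrink the empty square until it has \<open>a\<close> and \<open>b\<close> on opposite sides and slide it
  until \<open>a\<close> is a corner or a further point \<open>g\<close> lies on its boundary; then \<open>a g\<close> and \<open>g b\<close> each lie on a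
  smaller empty square with one of the two points as a corner. In the corner case, the Yao edge from
  the other point towards the corner leaves the square, and emptiness controls the sides through which
  the paths between its target and the corner leave their box.
\<close>

section \<open>Frames\<close>

text \<open>The length bound is part of the relation, with slack allowed at every step. Estimates
  therefore compose through \<open>linked_trans\<close> and \<open>linked_mono\<close>, and actual
  walk lengths appear only in \<open>linked_walk\<close>.\<close>

inductive linked :: "(point \<Rightarrow> point \<Rightarrow> bool) \<Rightarrow> point \<Rightarrow> point \<Rightarrow> real \<Rightarrow> bool"
  for E where
  linked_refl: "0 \<le> L \<Longrightarrow> linked E p p L"
| linked_step: "E p r \<Longrightarrow> linked E r q L \<Longrightarrow> dist p r + L \<le> L' \<Longrightarrow> linked E p q L'"

lemma linked_mono: "linked E p q L \<Longrightarrow> L \<le> L' \<Longrightarrow> linked E p q L'"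
  by (induction rule: linked.induct) (auto intro: linked.linked_refl linked.linked_step[OF _ _ order.trans])

lemma linked_trans: "linked E p q L \<Longrightarrow> linked E q r M \<Longrightarrow> linked E p r (L + M)"
proof (induction rule: linked.induct)
  case (linked_refl L p)
  then show ?case by (auto intro: linked_mono)
next
  case (linked_step p s q L L')
  then have "E p s" "linked E s r (L + M)" "dist p s + (L + M) \<le> L' + M" by auto
  then show ?case by (rule linked.linked_step)
qed

lemma linked_edge: "E p q \<Longrightarrow> dist p q \<le> L \<Longrightarrow> linked E p q L"
  by (rule linked_step[of E p q q 0]) (simp_all add: linked_refl)

lemma linked_sym:
  assumes "linked E p q L" and E_sym: "\<And>p q. E p q \<Longrightarrow> E q p"
  shows "linked E q p L"
  using assms(1)
proof (induction rule: linked.induct)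
  case (linked_refl L p)
  then show ?case by (auto intro: linked.linked_refl)
next
  case (linked_step p r q L L')
  have "linked E r p (dist p r)"
    by (rule linked_edge) (simp_all add: dist_commute E_sym[OF linked_step(1)])
  with linked_step.IH have "linked E q p (L + dist p r)" by (rule linked_trans)
  then show ?case using linked_step(3) by (auto intro: linked_mono)
qed

lemma linked_walk:
  assumes "linked E p q L"
  shows "\<exists>ps. is_walk E ps p q \<and> walk_length ps \<le> L"
  using assms
proof (induction rule: linked.induct)
  case (linked_refl L p)
  then show ?case
    by (auto intro!: exI[of _ "[p]"] simp: is_walk_def walk_length_def)
next
  case (linked_step p r q L L')
  then obtain ps where ps: "is_walk E ps r q" "walk_length ps \<le> L" by auto
  then obtain qs where qs: "ps = r # qs" by (cases ps) (auto simp: is_walk_def)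
  have "is_walk E (p # ps) p q"
    using ps(1) linked_step(1) qs by (auto simp: is_walk_def nth_Cons split: nat.splits)
  moreover have "walk_length (p # ps) = dist p r + walk_length ps"
    by (simp add: walk_length_def qs sum.lessThan_Suc_shift del: sum.lessThan_Suc)
  ultimately show ?case using ps(2) linked_step(3) by (intro exI[of _ "p # ps"]) auto
qed

section \<open>L1 distance, nearest points in a quadrant, and patterns of intersecting edges\<close>

definition l1dist :: "point \<Rightarrow> point \<Rightarrow> real" where
  "l1dist p q = \<bar>fst p - fst q\<bar> + \<bar>snd p - snd q\<bar>"

lemma l1dist_commute: "l1dist p q = l1dist q p"
  by (simp add: l1dist_def abs_minus_commute)

lemma dist_le_l1dist: "dist p q \<le> l1dist p q"
  by (cases p; cases q) (simp add: l1dist_def dist_Pair_Pair dist_real_def sqrt_sum_squares_le_sum_abs)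

lemma l1dist_le_dist: "l1dist p q \<le> sqrt 2 * dist p q"
proof (rule power2_le_imp_le)
  show "(l1dist p q)\<^sup>2 \<le> (sqrt 2 * dist p q)\<^sup>2"
    using sum_squares_bound[of "\<bar>fst p - fst q\<bar>" "\<bar>snd p - snd q\<bar>"]
    by (cases p; cases q)
      (simp add: l1dist_def dist_Pair_Pair dist_real_def power_mult_distrib power2_sum)
qed auto

definition nearest ::
  "point set \<Rightarrow> (point \<Rightarrow> point \<Rightarrow> bool) \<Rightarrow> (point \<Rightarrow> point \<Rightarrow> bool) \<Rightarrow> (point \<Rightarrow> point \<Rightarrow> bool) \<Rightarrow> point \<Rightarrow> point \<Rightarrow> bool"
  where "nearest V E l1 l2 u v \<longleftrightarrow> v \<in> V \<and> E u v \<and> l1 u v \<and> l2 u v \<and>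
     (\<forall>w\<in>V. l1 u w \<longrightarrow> l2 u w \<longrightarrow> dist u v \<le> dist u w)"

lemma nearest_swap: "nearest V E l1 l2 u v \<longleftrightarrow> nearest V E l2 l1 u v"
  by (auto simp: nearest_def)

definition span_box :: "point set \<Rightarrow> (point \<Rightarrow> point \<Rightarrow> bool) \<Rightarrow> (point \<Rightarrow> point \<Rightarrow> bool) \<Rightarrow> point \<Rightarrow> point \<Rightarrow> point set"
  where "span_box V l1 l2 p q =
     {t \<in> V. (t = p \<or> l1 p t \<and> l2 p t) \<and> (t = q \<or> l1 t q \<and> l2 t q)}"

text \<open>A Yao edge \<open>x \<rightarrow> y\<close> and one in the opposite direction, \<open>u \<rightarrow> v\<close>, such that the two
  segments intersect properly.\<close>
definition crossing ::
  "point set \<Rightarrow> (point \<Rightarrow> point \<Rightarrow> bool) \<Rightarrow> (point \<Rightarrow> point \<Rightarrow> bool) \<Rightarrow> (point \<Rightarrow> point \<Rightarrow> bool) \<Rightarrow>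
   point \<Rightarrow> point \<Rightarrow> point \<Rightarrow> point \<Rightarrow> bool"
  where "crossing V E l1 l2 x y u v \<longleftrightarrow> x \<in> V \<and> u \<in> V \<and>
     nearest V E l1 l2 x y \<and> nearest V E (conversep l1) (conversep l2) u v \<and>
     l1 x v \<and> l1 u y \<and> l2 v x \<and> l2 y u"

text \<open>The only way in which Yao edges \<open>a \<rightarrow> b\<close> and \<open>c \<rightarrow> d\<close> in adjacent directions can intersect, up to
  symmetry; \<open>b d\<close> is then a short side of the quadrilateral of their endpoints.\<close>
definition hook ::
  "point set \<Rightarrow> (point \<Rightarrow> point \<Rightarrow> bool) \<Rightarrow> (point \<Rightarrow> point \<Rightarrow> bool) \<Rightarrow> (point \<Rightarrow> point \<Rightarrow> bool) \<Rightarrow>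
   point \<Rightarrow> point \<Rightarrow> point \<Rightarrow> point \<Rightarrow> bool"
  where "hook V E l1 l2 a b c d \<longleftrightarrow> a \<in> V \<and> c \<in> V \<and>
     nearest V E l1 l2 a b \<and> nearest V E (conversep l1) l2 c d \<and>
     l1 a d \<and> l2 a d \<and> l2 c a \<and> l1 c b"

text \<open>Coordinates together with strict total orders \<open>lx\<close>, \<open>ly\<close> that
  refine them, so that distinct points always compare strictly and quadrants become products of two
  order conditions. The notion is invariant under swapping and reversing axes, hence each geometric
  argument is needed in one orientation only. \<open>tie_X\<close> and \<open>tie_Y\<close> say that
  all ties along an axis are broken in the same direction.\<close>

locale frame =
  fixes V :: "point set" and E :: "point \<Rightarrow> point \<Rightarrow> bool"
    and X Y :: "point \<Rightarrow> real" and lx ly :: "point \<Rightarrow> point \<Rightarrow> bool"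
  assumes finV: "finite V"
    and E_sym: "E p q \<Longrightarrow> E q p"
    and dist_XY: "dist p q = sqrt ((X p - X q)\<^sup>2 + (Y p - Y q)\<^sup>2)"
    and l1_XY: "l1dist p q = \<bar>X p - X q\<bar> + \<bar>Y p - Y q\<bar>"
    and lx_total: "p \<noteq> q \<Longrightarrow> lx p q \<or> lx q p"
    and lx_asym: "lx p q \<Longrightarrow> \<not> lx q p"
    and lx_trans: "lx p q \<Longrightarrow> lx q r \<Longrightarrow> lx p r"
    and lx_X: "lx p q \<Longrightarrow> X p \<le> X q"
    and ly_total: "p \<noteq> q \<Longrightarrow> ly p q \<or> ly q p"
    and ly_asym: "ly p q \<Longrightarrow> \<not> ly q p"
    and ly_trans: "ly p q \<Longrightarrow> ly q r \<Longrightarrow> ly p r"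
    and ly_Y: "ly p q \<Longrightarrow> Y p \<le> Y q"
    and tie_X: "X p = X q \<Longrightarrow> Y p < Y q \<Longrightarrow> X p' = X q' \<Longrightarrow> Y p' < Y q' \<Longrightarrow> lx p q \<Longrightarrow> lx p' q'"
    and tie_Y: "Y p = Y q \<Longrightarrow> X p < X q \<Longrightarrow> Y p' = Y q' \<Longrightarrow> X p' < X q' \<Longrightarrow> ly p q \<Longrightarrow> ly p' q'"
    and nearest_ex: "l1 \<in> {lx, conversep lx} \<Longrightarrow> l2 \<in> {ly, conversep ly} \<Longrightarrow>
       u \<in> V \<Longrightarrow> w \<in> V \<Longrightarrow> l1 u w \<Longrightarrow> l2 u w \<Longrightarrow> \<exists>v. nearest V E l1 l2 u v"

section \<open>Symmetries of a frame\<close>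

lemma frame_swap:
  assumes "frame V E X Y lx ly"
  shows "frame V E Y X ly lx"
proof -
  interpret frame V E X Y lx ly by fact
  show ?thesis
  proof
    show "dist p q = sqrt ((Y p - Y q)\<^sup>2 + (X p - X q)\<^sup>2)" for p q
      by (simp add: dist_XY[of p q] add.commute)
    show "l1dist p q = \<bar>Y p - Y q\<bar> + \<bar>X p - X q\<bar>" for p q
      by (simp add: l1_XY[of p q])
    show "\<exists>v. nearest V E l1 l2 u v"
      if "l1 \<in> {ly, conversep ly}" "l2 \<in> {lx, conversep lx}"
        "u \<in> V" "w \<in> V" "l1 u w" "l2 u w" for l1 l2 u w
      using nearest_ex[of l2 l1 u w] that nearest_swap by metis
  qed (fact finV E_sym lx_total lx_asym lx_trans lx_X ly_total ly_asym ly_trans ly_Y tie_X tie_Y)+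
qed

lemma frame_flipX:
  assumes "frame V E X Y lx ly"
  shows "frame V E (\<lambda>p. - X p) Y (conversep lx) ly"
proof -
  interpret frame V E X Y lx ly by fact
  show ?thesis
  proof
    show "finite V" by (rule finV)
    show "E p q \<Longrightarrow> E q p" for p q by (rule E_sym)
    show "dist p q = sqrt ((- X p - - X q)\<^sup>2 + (Y p - Y q)\<^sup>2)" for p q
      by (simp add: dist_XY[of p q] power2_commute)
    show "l1dist p q = \<bar>- X p - - X q\<bar> + \<bar>Y p - Y q\<bar>" for p q
      unfolding l1_XY[of p q] by linarith
    show "p \<noteq> q \<Longrightarrow> conversep lx p q \<or> conversep lx q p" for p q
      using lx_total[of p q] by auto
    show "conversep lx p q \<Longrightarrow> \<not> conversep lx q p" for p q
      using lx_asym by auto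
    show "conversep lx p q \<Longrightarrow> conversep lx q r \<Longrightarrow> conversep lx p r" for p q r
      using lx_trans[of r q p] by auto
    show "conversep lx p q \<Longrightarrow> - X p \<le> - X q" for p q
      using lx_X by auto
    show "p \<noteq> q \<Longrightarrow> ly p q \<or> ly q p" for p q by (rule ly_total)
    show "ly p q \<Longrightarrow> \<not> ly q p" for p q by (rule ly_asym)
    show "ly p q \<Longrightarrow> ly q r \<Longrightarrow> ly p r" for p q r by (rule ly_trans)
    show "ly p q \<Longrightarrow> Y p \<le> Y q" for p q by (rule ly_Y)
    \<comment> \<open>Reversing \<open>lx\<close> reverses the tie-break of all vertical pairs at
      once, so this is the contrapositive of \<open>tie_X\<close> with the two pairs
      interchanged.\<close>
    show "conversep lx p' q'"
      if "- X p = - X q" "Y p < Y q" "- X p' = - X q'" "Y p' < Y q'" "conversep lx p q" for p q p' q'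
      using that tie_X[of p' q' p q] lx_total[of p' q'] lx_asym[of q p] by auto
    show "ly p' q'"
      if "Y p = Y q" "- X p < - X q" "Y p' = Y q'" "- X p' < - X q'" "ly p q" for p q p' q'
      using that tie_Y[of q' p' q p] ly_total[of p' q'] ly_asym[of p q] by auto
    show "\<exists>v. nearest V E l1 l2 u v"
      if "l1 \<in> {conversep lx, conversep (conversep lx)}" "l2 \<in> {ly, conversep ly}"
        "u \<in> V" "w \<in> V" "l1 u w" "l2 u w" for l1 l2 u w
      using that nearest_ex[of l1 l2 u w] by auto
  qed
qed

lemma frame_flipY:
  assumes "frame V E X Y lx ly"
  shows "frame V E X (\<lambda>p. - Y p) lx (conversep ly)"
  by (rule frame_swap[OF frame_flipX[OF frame_swap[OF assms]]])

context frame
begin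

lemma dist_sq: "(dist p q)\<^sup>2 = (X p - X q)\<^sup>2 + (Y p - Y q)\<^sup>2"
  unfolding dist_XY by simp

lemma eq_if_coords_eq: "X p = X q \<Longrightarrow> Y p = Y q \<Longrightarrow> p = q"
  using dist_sq[of p q] by simp

lemma dist_less_if_between:
  assumes "X u \<le> X w" "X w \<le> X v" "Y u \<le> Y w" "Y w \<le> Y v" "w \<noteq> v"
  shows "dist u w < dist u v"
proof -
  have "\<bar>X u - X w\<bar> \<le> \<bar>X u - X v\<bar>" "\<bar>Y u - Y w\<bar> \<le> \<bar>Y u - Y v\<bar>"
    using assms by auto
  then have "(X u - X w)\<^sup>2 \<le> (X u - X v)\<^sup>2" "(Y u - Y w)\<^sup>2 \<le> (Y u - Y v)\<^sup>2"
    by (simp_all add: abs_le_square_iff)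
  moreover have "\<bar>X u - X w\<bar> < \<bar>X u - X v\<bar> \<or> \<bar>Y u - Y w\<bar> < \<bar>Y u - Y v\<bar>"
    using eq_if_coords_eq[of w v] assms by linarith
  then have "(X u - X w)\<^sup>2 < (X u - X v)\<^sup>2 \<or> (Y u - Y w)\<^sup>2 < (Y u - Y v)\<^sup>2"
    by (metis abs_le_square_iff not_le)
  ultimately have "(dist u w)\<^sup>2 < (dist u v)\<^sup>2" by (auto simp: dist_sq)
  then show ?thesis by (rule power2_less_imp_less) auto
qed

lemma nearest_le: "nearest V E l1 l2 u v \<Longrightarrow> w \<in> V \<Longrightarrow> l1 u w \<Longrightarrow> l2 u w \<Longrightarrow> dist u v \<le> dist u w"
  by (auto simp: nearest_def)

end

section \<open>Paths towards a point\<close>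

context frame
begin

lemma lx_irrefl [simp]: "\<not> lx p p" and ly_irrefl [simp]: "\<not> ly p p"
  using lx_asym ly_asym by blast+

lemma lx_if_less: "X p < X q \<Longrightarrow> lx p q"
  by (metis lx_X lx_total leD order_less_irrefl)

lemma ly_if_less: "Y p < Y q \<Longrightarrow> ly p q"
  by (metis ly_Y ly_total leD order_less_irrefl)

lemma not_lx_iff: "\<not> lx p q \<longleftrightarrow> q = p \<or> lx q p"
  by (metis lx_asym lx_irrefl lx_total)

lemma not_ly_iff: "\<not> ly p q \<longleftrightarrow> q = p \<or> ly q p"
  by (metis ly_asym ly_irrefl ly_total)

lemma dist_less_NE: "lx u w \<Longrightarrow> ly u w \<Longrightarrow> lx w v \<Longrightarrow> ly w v \<Longrightarrow> dist u w < dist u v"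
  by (rule dist_less_if_between) (auto intro: lx_X ly_Y)

lemma dist_less_SW: "lx w u \<Longrightarrow> ly w u \<Longrightarrow> lx v w \<Longrightarrow> ly v w \<Longrightarrow> dist u w < dist u v"
proof -
  assume *: "lx w u" "ly w u" "lx v w" "ly v w"
  interpret fl: frame V E "\<lambda>p. - X p" "\<lambda>p. - Y p" "conversep lx" "conversep ly"
    by (intro frame_flipX frame_flipY frame_axioms)
  show ?thesis by (rule fl.dist_less_NE) (use * in auto)
qed

lemma nearest_NE_ex: "u \<in> V \<Longrightarrow> w \<in> V \<Longrightarrow> lx u w \<Longrightarrow> ly u w \<Longrightarrow> \<exists>v. nearest V E lx ly u v"
  by (rule nearest_ex) auto

lemma nearest_SW_ex:
  "u \<in> V \<Longrightarrow> w \<in> V \<Longrightarrow> lx w u \<Longrightarrow> ly w u \<Longrightarrow> \<exists>v. nearest V E (conversep lx) (conversep ly) u v"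
  by (rule nearest_ex) auto

text \<open>Along a monotone path L1 distances telescope, so such a path costs at most the L1
  distance of its ends, however many edges it has.\<close>

lemma l1dist_NE_add: "lx p r \<Longrightarrow> ly p r \<Longrightarrow> lx r q \<Longrightarrow> ly r q \<Longrightarrow> l1dist p r + l1dist r q = l1dist p q"
  using lx_X[of p r] lx_X[of r q] ly_Y[of p r] ly_Y[of r q] by (simp add: l1_XY)

lemma l1dist_self [simp]: "l1dist p p = 0"
  by (simp add: l1dist_def)

lemma l1dist_box_add: "r \<in> span_box V lx ly p q \<Longrightarrow> l1dist p r + l1dist r q = l1dist p q"
  using l1dist_NE_add[of p r q] by (auto simp: span_box_def)

lemma linked_nearest: "nearest V E l1 l2 u v \<Longrightarrow> linked E u v (l1dist u v)"
  by (auto simp: nearest_def intro: linked_edge dist_le_l1dist)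

text \<open>Follow Yao edges from \<open>p\<close> towards \<open>q\<close> and from \<open>q\<close> towards \<open>p\<close> while inside the box they
  span. If the first path leaves the box through its right side, then \<open>q\<close> lies above it, and the
  point where the second path gets below it is a crossing.\<close>
lemma path_cases:
  assumes pV: "p \<in> V" and qV: "q \<in> V" and pq: "lx p q" "ly p q"
  obtains
    (joined) "linked E p q (l1dist p q)"
  | (crossing) x y u v where "x \<in> span_box V lx ly p q" "u \<in> span_box V lx ly p q"
      "linked E p x (l1dist p x)" "linked E u q (l1dist u q)" "crossing V E lx ly x y u v"
  | (top) t t' where "t \<in> span_box V lx ly p q" "t \<noteq> q" "linked E p t (l1dist p t)"
      "nearest V E lx ly t t'" "lx t' q" "ly q t'"
  | (left) t t' where "t \<in> span_box V lx ly p q" "t \<noteq> p" "linked E t q (l1dist t q)"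
      "nearest V E (conversep lx) (conversep ly) t t'" "lx t' p" "ly p t'"
proof -
  define B where "B = span_box V lx ly p q"
  define F where "F t = (SOME t'. nearest V E lx ly t t')" for t
  define g where "g n = (F ^^ n) p" for n
  have g0: "g 0 = p" and gS: "g (Suc n) = F (g n)" for n
    by (simp_all add: g_def)
  have pB: "p \<in> B" and qB: "q \<in> B"
    using pV qV pq by (auto simp: B_def span_box_def)
  have F: "nearest V E lx ly t (F t)" if "t \<in> B" "t \<noteq> q" for t
    unfolding F_def using that qV
    by (intro someI_ex[of "nearest V E lx ly t"] nearest_NE_ex[of t q]) (auto simp: B_def span_box_def)
  \<comment> \<open>A path staying in the box forever would be an infinite strictly
    \<open>lx\<close>-increasing sequence in the finite set \<open>V\<close>.\<close>
  have "\<exists>n. g n \<notin> B \<or> g n = q"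
  proof (rule ccontr)
    assume "\<not> ?thesis"
    then have *: "g n \<in> B" "g n \<noteq> q" for n by auto
    have step: "lx (g n) (g (Suc n))" for n
      using F[OF *] by (auto simp: gS nearest_def)
    have "lx (g n) (g m)" if "n < m" for n m
      using that by (induction m) (auto simp: less_Suc_eq intro: lx_trans step)
    then have "inj g"
      by (metis injI lx_irrefl linorder_neqE_nat)
    moreover have "range g \<subseteq> V" using * by (auto simp: B_def span_box_def)
    ultimately show False
      using finV finite_subset finite_imageD[of g UNIV] by auto
  qed
  define N where "N = (LEAST n. g n \<notin> B \<or> g n = q)"
  have gN: "g N \<notin> B \<or> g N = q"
    unfolding N_def by (rule LeastI_ex) fact
  have gB: "g n \<in> B" "g n \<noteq> q" if "n < N" for n
    using not_less_Least[of n] that unfolding N_def by blast+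
  have gF: "nearest V E lx ly (g n) (g (Suc n))" if "n < N" for n
    using F[OF gB] that by (simp add: gS)
  have glt: "lx (g n) (g m) \<and> ly (g n) (g m)" if "n < m" "m \<le> N" for n m
    using that
  proof (induction m)
    case (Suc m)
    have "lx (g m) (g (Suc m))" "ly (g m) (g (Suc m))"
      using gF[of m] Suc by (auto simp: nearest_def)
    then show ?case
      using Suc by (cases "n = m") (auto intro: lx_trans ly_trans)
  qed auto
  have glink: "linked E p (g n) (l1dist p (g n))" if "n \<le> N" for n
    using that
  proof (induction n)
    case 0
    then show ?case by (auto simp: g0 intro: linked_refl)
  next
    case (Suc n)
    have e: "nearest V E lx ly (g n) (g (Suc n))" using gF Suc by auto
    have "l1dist p (g n) + l1dist (g n) (g (Suc n)) = l1dist p (g (Suc n))"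
      using l1dist_NE_add[of "g 0" "g n" "g (Suc n)"] glt[of 0 n] e Suc.prems
      by (cases "n = 0") (auto simp: g0 nearest_def)
    then show ?case
      using linked_trans[OF Suc.IH linked_nearest[OF e]] Suc.prems by auto
  qed
  show thesis
  proof (cases "g N = q")
    case True
    then show ?thesis using glink[of N] joined by auto
  next
    case False
    then have gNB: "g N \<notin> B" using gN by auto
    have "N \<noteq> 0" using gNB pB by (auto simp: g0 intro: gr0I)
    then obtain n where n: "N = Suc n" by (cases N) auto
    have nB: "g n \<in> B" "g n \<noteq> q" and nN: "nearest V E lx ly (g n) (g N)"
      using gB[of n] gF[of n] by (auto simp: n)
    have nq: "lx (g n) q" "ly (g n) q" using nB by (auto simp: B_def span_box_def)
    have gNV: "g N \<in> V" "lx p (g N)" "ly p (g N)"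
      using nN glt[of 0 N] by (auto simp: nearest_def n g0)
    \<comment> \<open>As \<open>q\<close> competes for being nearest to \<open>g n\<close>, the path
      cannot jump beyond \<open>q\<close> in both orders; it leaves through the top or through the
      right side.\<close>
    have "dist (g n) (g N) \<le> dist (g n) q"
      using nearest_le[OF nN] qV nq by auto
    then have "\<not> (lx q (g N) \<and> ly q (g N))"
      using dist_less_NE[of "g n" q "g N"] nq by auto
    moreover have "\<not> (lx (g N) q \<and> ly (g N) q)"
      using gNB gNV by (auto simp: B_def span_box_def)
    ultimately consider "lx (g N) q" "ly q (g N)" | "lx q (g N)" "ly (g N) q"
      using False lx_total ly_total by blast
    then show ?thesis
    proof cases
      case 1
      then show ?thesis using top[of "g n" "g N"] nB nN glink[of n] by (auto simp: B_def n)
    next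
      case 2
      \<comment> \<open>The half-open \<open>lx\<close>-range of the edge from \<open>g k\<close> to
        \<open>g (Suc k)\<close> contains \<open>u\<close>, and \<open>u\<close> is not below the
        start of that edge. Equality \<open>u = g k\<close> is allowed and means that the paths
        meet.\<close>
      define above where "above u k \<longleftrightarrow> k < N \<and> \<not> lx u (g k) \<and> lx u (g (Suc k)) \<and> \<not> ly u (g k)" for u k
      have idx: "\<exists>k<N. \<not> lx u (g k) \<and> lx u (g (Suc k))" if "\<not> lx u p" "\<not> lx q u" for u
      proof -
        have "lx u (g N)" using 2(1) that(2) by (metis lx_total lx_trans)
        then show ?thesis
          using ex_least_nat_less[of "\<lambda>i. lx u (g i)" N] that(1) by (auto simp: g0)
      qed
      have "thesis" if "u \<in> B" "linked E u q (l1dist u q)" "above u k" for u k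
        using that
      \<comment> \<open>Follows the second path from \<open>q\<close>: each of its edges moves
        \<open>u\<close> to the left.\<close>
      proof (induction "card {t \<in> V. lx t u}" arbitrary: u k rule: less_induct)
        case less
        have k: "k < N" "\<not> lx u (g k)" "lx u (g (Suc k))" "\<not> ly u (g k)"
          using less.prems(3) by (auto simp: above_def)
        have uV: "u \<in> V" using less.prems by (auto simp: B_def span_box_def)
        have kV: "g k \<in> V" using gB[of k] k by (auto simp: B_def span_box_def)
        show ?case
        proof (cases "u = g k")
          case True
          have "l1dist p u + l1dist u q = l1dist p q"
            using less.prems(1) unfolding B_def by (rule l1dist_box_add)
          then show ?thesis
            using linked_trans[OF glink[of k] less.prems(2)[unfolded True]] k joined True by auto
        next
          case ne: False
          have gku: "lx (g k) u" "ly (g k) u"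
            using k ne not_lx_iff not_ly_iff by blast+
          have up: "u \<noteq> p"
            using gku gB(1)[of k] k lx_asym by (auto simp: B_def span_box_def)
          have pu: "lx p u" "ly p u"
            using less.prems(1) up by (auto simp: B_def span_box_def)
          obtain v where v: "nearest V E (conversep lx) (conversep ly) u v"
            using nearest_SW_ex[OF uV pV] pu by auto
          have vV: "v \<in> V" "lx v u" "ly v u" using v by (auto simp: nearest_def)
          have vq: "lx v q" "ly v q"
            using less.prems(1) vV by (auto simp: B_def span_box_def intro: lx_trans ly_trans)
          have vlink: "linked E v q (l1dist v q)"
          proof -
            have "linked E v u (l1dist v u)"
              using linked_sym[OF linked_nearest[OF v] E_sym] by (simp add: l1dist_commute)
            moreover have "l1dist v u + l1dist u q = l1dist v q"
              using l1dist_NE_add[of v u q] vV less.prems(1) by (auto simp: B_def span_box_def)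
            ultimately show ?thesis using linked_trans less.prems(2) by metis
          qed
          have "dist u v \<le> dist u p" using nearest_le[OF v pV] pu by auto
          then have nb: "\<not> (lx v p \<and> ly v p)"
            using dist_less_SW[of p u v] pu by auto
          show ?thesis
          proof (cases "lx v p")
            case True
            then have "ly p v" using nb ly_total[of v p] lx_irrefl[of p] by metis
            then show ?thesis
              using left[of u v] less.prems v up True by (auto simp: B_def)
          next
            case False
            then obtain k' where k': "k' < N" "\<not> lx v (g k')" "lx v (g (Suc k'))"
              using idx[of v] vq lx_asym by blast
            show ?thesis
            proof (cases "ly v (g k')")
              case below: True
              \<comment> \<open>If \<open>k' < k\<close>, then \<open>g k\<close> would lie in the
                quadrant of \<open>u\<close> that contains \<open>v\<close> and would be nearer than
                \<open>v\<close>. If \<open>k < k'\<close>, then \<open>v\<close> could not be to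
                the left of \<open>u\<close>.\<close>
              have "k' = k"
              proof (rule ccontr)
                assume "k' \<noteq> k"
                then consider "k' < k" | "k < k'" by linarith
                then show False
                proof cases
                  case 1
                  have "lx v (g k)"
                    using k' glt[of "Suc k'" k] 1 k lx_trans by (cases "Suc k' = k") auto
                  moreover have "ly v (g k)"
                    using below glt[of k' k] 1 k ly_trans by auto
                  ultimately have "dist u (g k) < dist u v"
                    using gku by (intro dist_less_SW) auto
                  moreover have "dist u v \<le> dist u (g k)"
                    using nearest_le[OF v kV] gku by auto
                  ultimately show False by simp
                next
                  case 2
                  have "lx (g k') u"
                    using k'(2) vV(2) not_lx_iff lx_trans by metis
                  moreover have "g (Suc k) = g k' \<or> lx (g (Suc k)) (g k')"
                    using glt[of "Suc k" k'] 2 k' by (cases "Suc k = k'") auto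
                  ultimately show False using k(3) lx_trans lx_asym by metis
                qed
              qed
              have "v \<noteq> g k" using below \<open>k' = k\<close> by auto
              then have xv: "lx (g k) v" "ly v (g k)"
                using k' below \<open>k' = k\<close> \<open>v \<noteq> g k\<close> not_lx_iff[of v "g k"] by auto
              have nk: "nearest V E lx ly (g k) (g (Suc k))" using gF k by auto
              \<comment> \<open>If \<open>g (Suc k)\<close> were above \<open>u\<close>, then
                \<open>u\<close> would be nearer to \<open>g k\<close>.\<close>
              have "dist (g k) (g (Suc k)) \<le> dist (g k) u"
                using nearest_le[OF nk uV] gku by auto
              then have "ly (g (Suc k)) u"
                using dist_less_NE[of "g k" u "g (Suc k)"] gku k(3) ly_total[of u "g (Suc k)"] lx_irrefl
                by force
              then have "crossing V E lx ly (g k) (g (Suc k)) u v"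
                using kV uV nk v xv k(3) by (auto simp: crossing_def)
              then show ?thesis
                using crossing[of "g k" u "g (Suc k)" v] gB[of k] k less.prems glink[of k]
                by (auto simp: B_def)
            next
              case nbelow: False
              have "v = p \<or> ly p v"
                using nbelow gB(1)[of k'] k'(1) not_ly_iff[of v "g k'"] ly_trans[of p "g k'" v] by (auto simp: B_def span_box_def)
              then have "v \<in> B"
                using vV vq False lx_total[of v p] by (auto simp: B_def span_box_def)
              moreover have "above v k'" using k' nbelow by (auto simp: above_def)
              moreover have "{t \<in> V. lx t v} \<subset> {t \<in> V. lx t u}"
                using vV(1,2) lx_trans[of _ v u] lx_irrefl[of v] by blast
              then have "card {t \<in> V. lx t v} < card {t \<in> V. lx t u}"
                using finV by (intro psubset_card_mono) auto
              ultimately show ?thesis using less.hyps[of v k'] vlink by auto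
            qed
          qed
        qed
      qed
      moreover obtain k where k: "k < N" "\<not> lx q (g k)" "lx q (g (Suc k))"
        using idx[of q] pq lx_asym by auto
      moreover have "above q k"
        using k gB(1)[OF k(1)] ly_asym[of q "g k"] by (auto simp: above_def B_def span_box_def)
      ultimately show ?thesis using qB by (auto simp: linked_refl)
    qed
  qed
qed

end

section \<open>Intersecting Yao edges\<close>

lemma linked_join:
  "linked E p x A \<Longrightarrow> linked E x y B \<Longrightarrow> linked E y q C \<Longrightarrow> A + B + C \<le> L \<Longrightarrow> linked E p q L"
  by (meson linked_mono linked_trans)

section \<open>Numerical inequalities behind the contraction\<close>

lemma sqrt2_le: "sqrt 2 \<le> 70711/50000"
  by (rule real_le_lsqrt) (auto simp: power2_eq_square)

lemma l1dist_le: "l1dist p q \<le> 70711/50000 * dist p q"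
  using l1dist_le_dist[of p q] mult_right_mono[OF sqrt2_le, of "dist p q"] by simp

text \<open>For a hook with \<open>a\<close> as origin, \<open>d\<close> is \<open>(d1, d2)\<close>,
  \<open>b\<close> is \<open>(b1, b2)\<close> and \<open>c\<close> is \<open>(p, -q)\<close>. The
  last two hypotheses say that \<open>b\<close> is no farther from \<open>a\<close> than
  \<open>d\<close> is, and that \<open>d\<close> is no farther from \<open>c\<close> than
  \<open>a\<close> is. Expanding the squared distance of \<open>b\<close> and \<open>d\<close> and
  inserting both gives the first bound.\<close>

lemma hook_bounds:
  fixes p q d1 d2 b1 b2 :: real
  assumes "0 \<le> d1" "d1 \<le> p" "p \<le> b1" "0 \<le> b2" "0 \<le> d2" "0 \<le> q"
    and b: "b1\<^sup>2 + b2\<^sup>2 \<le> d1\<^sup>2 + d2\<^sup>2" and d: "(p - d1)\<^sup>2 + (q + d2)\<^sup>2 \<le> p\<^sup>2 + q\<^sup>2"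
  shows "(b1 - d1)\<^sup>2 + (b2 - d2)\<^sup>2 \<le> d1\<^sup>2 + d2\<^sup>2 - 2 * q * d2"
    and "3 * ((b1 - d1)\<^sup>2 + (b2 - d2)\<^sup>2) \<le> 4 * d2\<^sup>2"
    and "d1\<^sup>2 + d2\<^sup>2 \<le> (2 * d1)\<^sup>2"
    and "d1\<^sup>2 + d2\<^sup>2 \<le> 2 * p * d1"
    and "b2 \<le> d2"
proof -
  have H: "d1\<^sup>2 + d2\<^sup>2 + 2 * q * d2 \<le> 2 * p * d1"
    using d by (simp add: power2_eq_square algebra_simps)
  have q: "0 \<le> q * d2" and pb: "p * d1 \<le> b1 * d1" and b2d2: "0 \<le> b2 * d2"
    using assms by (auto intro: mult_right_mono)
  show F1: "(b1 - d1)\<^sup>2 + (b2 - d2)\<^sup>2 \<le> d1\<^sup>2 + d2\<^sup>2 - 2 * q * d2"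
    using H b pb b2d2 by (simp add: power2_eq_square algebra_simps)
  show F4: "d1\<^sup>2 + d2\<^sup>2 \<le> 2 * p * d1" using H q by simp
  have "d1\<^sup>2 \<le> b1\<^sup>2" using assms by (intro power_mono) auto
  then have "b2\<^sup>2 \<le> d2\<^sup>2" using b by simp
  then show bd: "b2 \<le> d2" using assms by (auto intro: power2_le_imp_le)
  have "p\<^sup>2 \<le> b1\<^sup>2" using assms by (intro power_mono) auto
  then have pp: "p\<^sup>2 \<le> d1\<^sup>2 + d2\<^sup>2" using b zero_le_power2[of b2] by linarith
  also note F4
  finally have "p * p \<le> p * (2 * d1)" by (simp add: power2_eq_square algebra_simps)
  then have p2: "p \<le> 2 * d1"
    using assms by (cases "p = 0") (auto simp: mult_le_cancel_left)
  have "2 * p * d1 \<le> 4 * d1\<^sup>2"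
    using mult_right_mono[OF p2, of d1] assms by (simp add: power2_eq_square algebra_simps)
  then show F3: "d1\<^sup>2 + d2\<^sup>2 \<le> (2 * d1)\<^sup>2" using F4 by (simp add: power2_eq_square algebra_simps)
  have "b1\<^sup>2 \<le> (2 * d1)\<^sup>2" using F3 b zero_le_power2[of b2] by linarith
  then have b12: "b1 \<le> 2 * d1" using assms by (auto intro: power2_le_imp_le)
  have "3 * (b1 - d1)\<^sup>2 \<le> (b1 - d1) * (b1 + d1)"
    using mult_left_mono[of "3 * (b1 - d1)" "b1 + d1" "b1 - d1"] b12 assms
    by (simp add: power2_eq_square algebra_simps)
  also have "\<dots> = b1\<^sup>2 - d1\<^sup>2" by (simp add: power2_eq_square algebra_simps)
  also have "\<dots> \<le> d2\<^sup>2 - b2\<^sup>2" using b by simp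
  finally have "3 * (b1 - d1)\<^sup>2 \<le> d2\<^sup>2 - b2\<^sup>2" .
  moreover have "(b2 - d2)\<^sup>2 \<le> d2\<^sup>2 - b2\<^sup>2"
    using mult_left_mono[OF bd \<open>0 \<le> b2\<close>] by (simp add: power2_eq_square algebra_simps)
  ultimately show "3 * ((b1 - d1)\<^sup>2 + (b2 - d2)\<^sup>2) \<le> 4 * d2\<^sup>2"
    using zero_le_power2[of b2] by argo
qed

text \<open>Here \<open>m\<close> is the short side of a hook and \<open>R\<close> bounds its long
  side. If \<open>m\<close> exceeded \<open>3/4 * R\<close>, then the second bound would force
  \<open>d\<close> above \<open>9/16 * R\<close>, and the first would leave at most
  \<open>7/16\<close> of the square of \<open>R\<close>, less than the square of
  \<open>3/4 * R\<close>.\<close>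

lemma hook_contraction:
  fixes m R q d :: real
  assumes m: "m\<^sup>2 \<le> R\<^sup>2 - 2 * q * d" and d: "3 * m\<^sup>2 \<le> 4 * d\<^sup>2"
    and "R \<le> 2 * q" "0 \<le> d" "0 \<le> m" "0 < R"
  shows "m \<le> 3/4 * R"
proof (rule ccontr)
  assume "\<not> ?thesis"
  then have mR: "3/4 * R < m" by simp
  then have "(3/4 * R)\<^sup>2 < m\<^sup>2" using assms by (intro power_strict_mono) auto
  moreover have "(3/4 * R)\<^sup>2 = 9/16 * R\<^sup>2" "(R * 9 / 16)\<^sup>2 = 81/256 * R\<^sup>2"
    by (simp_all add: power_mult_distrib power_divide)
  ultimately have "(R * 9 / 16)\<^sup>2 < d\<^sup>2" using d zero_le_power2[of R] by linarith
  then have "R * 9 / 16 < d" using assms power2_less_imp_less by blast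
  then have "R * (R * 9 / 16) \<le> 2 * q * d"
    using assms by (intro mult_mono) auto
  then have "m\<^sup>2 \<le> 7/16 * R\<^sup>2" using m by (simp add: power2_eq_square)
  then show False using \<open>(3/4 * R)\<^sup>2 < m\<^sup>2\<close> \<open>(3/4 * R)\<^sup>2 = 9/16 * R\<^sup>2\<close> zero_le_power2[of R] by linarith
qed

text \<open>For a crossing with \<open>x\<close> as origin, \<open>u\<close> is
  \<open>(p, q)\<close> and \<open>v\<close> is \<open>(v1, -v2)\<close>. As \<open>v\<close> is no
  farther from \<open>u\<close> than \<open>x\<close> is and \<open>p \<le> q\<close>,
  \<open>v2\<close> is at most \<open>(sqrt 2 - 1) * p\<close>, which \<open>83/200\<close> rounds
  up. The optimal contraction factor \<open>sqrt (2 - sqrt 2)\<close> is rounded up to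
  \<open>77/100\<close>.\<close>

lemma crossing_bounds:
  fixes p q v1 v2 :: real
  assumes "0 \<le> v1" "v1 \<le> p" "p \<le> q" "0 \<le> v2" and v: "(p - v1)\<^sup>2 + (q + v2)\<^sup>2 \<le> p\<^sup>2 + q\<^sup>2"
  shows "v1\<^sup>2 + v2\<^sup>2 \<le> (77/100)\<^sup>2 * (p\<^sup>2 + q\<^sup>2)" and "v1\<^sup>2 + v2\<^sup>2 \<le> 121/100 * p\<^sup>2"
proof -
  have "v2\<^sup>2 + 2 * q * v2 \<le> p\<^sup>2"
    using v zero_le_power2[of "p - v1"] unfolding power2_sum[of q] by linarith
  moreover have "p * v2 \<le> q * v2" using assms by (intro mult_right_mono) auto
  ultimately have *: "v2\<^sup>2 + 2 * (p * v2) \<le> p\<^sup>2" by simp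
  have v2: "v2 \<le> 83/200 * p"
  proof (rule ccontr)
    assume "\<not> ?thesis"
    then have less: "83/200 * p < v2" by simp
    then have "(83/200 * p)\<^sup>2 \<le> v2\<^sup>2" using assms by (intro power_mono) auto
    moreover have "p * (83/200 * p) \<le> p * v2"
      using mult_left_mono[of "83/200 * p" v2 p] less assms by auto
    moreover have "(83/200 * p)\<^sup>2 = 6889/40000 * p\<^sup>2" "p * (83/200 * p) = 83/200 * p\<^sup>2"
      by (simp_all add: power2_eq_square)
    ultimately have "p\<^sup>2 = 0" using * zero_le_power2[of p] by linarith
    then have "p = 0" by simp
    then show False using * less assms by simp
  qed
  have "v2\<^sup>2 \<le> (83/200 * p)\<^sup>2" using v2 assms by (intro power_mono) auto
  moreover have "v1\<^sup>2 \<le> p\<^sup>2" "p\<^sup>2 \<le> q\<^sup>2" using assms by (auto intro!: power_mono)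
  moreover have e: "(83/200 * p)\<^sup>2 = 6889/40000 * p\<^sup>2" "(77/100)\<^sup>2 = (5929/10000 :: real)"
    by (simp_all add: power_mult_distrib power_divide)
  ultimately show "v1\<^sup>2 + v2\<^sup>2 \<le> (77/100)\<^sup>2 * (p\<^sup>2 + q\<^sup>2)" "v1\<^sup>2 + v2\<^sup>2 \<le> 121/100 * p\<^sup>2"
    using zero_le_power2[of p] e by (simp_all only: distrib_left)
qed

section \<open>Geometry of hooks and crossings\<close>

context frame
begin

lemma hook_facts:
  assumes "hook V E lx ly a b c d"
  shows "(dist b d)\<^sup>2 \<le> (dist a d)\<^sup>2 - 2 * (Y a - Y c) * (Y d - Y a)"
    and "3 * (dist b d)\<^sup>2 \<le> 4 * (Y d - Y a)\<^sup>2"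
    and "dist a d \<le> 2 * (X d - X a)"
    and "(dist a d)\<^sup>2 \<le> 2 * (X c - X a) * (X d - X a)"
    and "dist b d \<le> dist a d"
    and "a \<in> V" "b \<in> V" "c \<in> V" "d \<in> V"
    and "lx d b" "ly b d" "lx d c" "ly a b" "ly c a" "lx a b"
proof -
  have h: "a \<in> V" "b \<in> V" "c \<in> V" "d \<in> V" "lx a b" "ly a b" "lx d c" "ly c d"
    "lx a d" "ly a d" "ly c a" "lx c b"
    using assms by (auto simp: hook_def nearest_def)
  have db: "lx d b" and ac: "lx a c" using h lx_trans by blast+
  have ab: "dist a b \<le> dist a d" and cd: "dist c d \<le> dist c a"
    using assms h ac by (auto simp: hook_def nearest_def)
  have "(dist a b)\<^sup>2 \<le> (dist a d)\<^sup>2" "(dist c d)\<^sup>2 \<le> (dist c a)\<^sup>2"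
    using ab cd by (auto intro: power_mono)
  then have
    "(X b - X a)\<^sup>2 + (Y b - Y a)\<^sup>2 \<le> (X d - X a)\<^sup>2 + (Y d - Y a)\<^sup>2"
    "((X c - X a) - (X d - X a))\<^sup>2 + ((Y a - Y c) + (Y d - Y a))\<^sup>2 \<le> (X c - X a)\<^sup>2 + (Y a - Y c)\<^sup>2"
    by (simp_all add: dist_sq power2_commute)
  note hb = hook_bounds[OF _ _ _ _ _ _ this]
  have o: "0 \<le> X d - X a" "X d - X a \<le> X c - X a" "X c - X a \<le> X b - X a" "0 \<le> Y b - Y a"
    "0 \<le> Y d - Y a" "0 \<le> Y a - Y c"
    using h lx_X[of a d] lx_X[of d c] lx_X[of c b] ly_Y[of a b] ly_Y[of a d] ly_Y[of c a] by auto
  note hb = hb[OF o]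
  show F1: "(dist b d)\<^sup>2 \<le> (dist a d)\<^sup>2 - 2 * (Y a - Y c) * (Y d - Y a)"
    using hb(1) by (simp add: dist_sq power2_commute)
  show "3 * (dist b d)\<^sup>2 \<le> 4 * (Y d - Y a)\<^sup>2"
    using hb(2) by (simp add: dist_sq power2_commute)
  show "dist a d \<le> 2 * (X d - X a)"
    using hb(3) o by (intro power2_le_imp_le[of "dist a d"]) (auto simp: dist_sq power2_commute)
  show "(dist a d)\<^sup>2 \<le> 2 * (X c - X a) * (X d - X a)"
    using hb(4) by (simp add: dist_sq power2_commute)
  have "0 \<le> (Y a - Y c) * (Y d - Y a)" using o by (intro mult_nonneg_nonneg)
  moreover have "2 * (Y a - Y c) * (Y d - Y a) = 2 * ((Y a - Y c) * (Y d - Y a))" by simp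
  ultimately have "(dist b d)\<^sup>2 \<le> (dist a d)\<^sup>2" using F1 by linarith
  then show "dist b d \<le> dist a d" by (rule power2_le_imp_le) simp
  show "a \<in> V" "b \<in> V" "c \<in> V" "d \<in> V" "lx d b" "lx d c" "ly a b" "ly c a" "lx a b"
    using h db by auto
  \<comment> \<open>Otherwise \<open>d\<close> would be nearer to \<open>a\<close> than the chosen
    neighbour \<open>b\<close>.\<close>
  show "ly b d"
  proof (rule ccontr)
    assume "\<not> ly b d"
    then have "ly d b" using db not_ly_iff[of b d] by auto
    then have "dist a d < dist a b" using h db by (intro dist_less_NE)
    then show False using ab by simp
  qed
qed

lemma crossing_facts:
  assumes "crossing V E lx ly x y u v"
  shows "x \<in> V" "y \<in> V" "u \<in> V" "v \<in> V" "lx x v" "lx v u" "lx u y" "ly v x" "ly x y" "ly y u"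
    "lx x u" "ly x u" "E x y" "E u v" "dist x y \<le> dist x u" "dist u v \<le> dist x u"
proof -
  show h: "x \<in> V" "y \<in> V" "u \<in> V" "v \<in> V" "lx x v" "lx v u" "lx u y" "ly v x" "ly x y" "ly y u"
    "E x y" "E u v"
    using assms by (auto simp: crossing_def nearest_def)
  show xu: "lx x u" "ly x u" using h lx_trans ly_trans by blast+
  show "dist x y \<le> dist x u" "dist u v \<le> dist x u"
    using assms h xu by (auto simp: crossing_def nearest_def dist_commute)
qed

lemma crossing_dist:
  assumes "crossing V E lx ly x y u v" "X u - X x \<le> Y u - Y x"
  shows "dist x v \<le> 77/100 * dist x u" "(dist x v)\<^sup>2 \<le> 121/100 * (X u - X x)\<^sup>2"
proof -
  note cf = crossing_facts[OF assms(1)]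
  have "(dist u v)\<^sup>2 \<le> (dist x u)\<^sup>2" using cf by (intro power_mono) auto
  then have "((X u - X x) - (X v - X x))\<^sup>2 + ((Y u - Y x) + (Y x - Y v))\<^sup>2
      \<le> (X u - X x)\<^sup>2 + (Y u - Y x)\<^sup>2"
    by (simp add: dist_sq power2_commute)
  note cb = crossing_bounds[OF _ _ _ _ this]
  have o: "0 \<le> X v - X x" "X v - X x \<le> X u - X x" "0 \<le> Y x - Y v"
    using cf lx_X[of x v] lx_X[of v u] ly_Y[of v x] by auto
  note cb = cb[OF o(1,2) assms(2) o(3)]
  have "(dist x v)\<^sup>2 \<le> (77/100)\<^sup>2 * (dist x u)\<^sup>2"
    using cb(1) by (simp add: dist_sq power2_commute)
  then show "dist x v \<le> 77/100 * dist x u"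
    by (intro power2_le_imp_le[of "dist x v"]) (auto simp: power_mult_distrib power_divide)
  show "(dist x v)\<^sup>2 \<le> 121/100 * (X u - X x)\<^sup>2"
    using cb(2) by (simp add: dist_sq power2_commute)
qed

text \<open>Reflection in an antidiagonal exchanges the two edges and turns a wide crossing into a
  tall one. Hence \<open>crossing_dist\<close> needs only the tall case.\<close>

lemma crossing_antidiagonal:
  assumes "crossing V E lx ly x y u v"
  shows "crossing V E (conversep ly) (conversep lx) u v x y"
  using assms by (simp add: crossing_def nearest_swap)

end

text \<open>\<open>p q\<close> has a short connection whenever it is the short side of an intersection; the quantifier over
  frames makes the induction hypothesis available for all reflections. The constant is chosen such that
  \<open>sqrt 2 + 25/4 * 77/100 \<le> 25/4\<close>, where \<open>sqrt 2\<close> pays for the paths and \<open>77/100\<close> is the contraction factor.\<close>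
definition good :: "point set \<Rightarrow> (point \<Rightarrow> point \<Rightarrow> bool) \<Rightarrow> point \<Rightarrow> point \<Rightarrow> bool" where
  "good V E p q \<longleftrightarrow> (\<forall>X Y lx ly. frame V E X Y lx ly \<longrightarrow>
     (\<forall>a c. hook V E lx ly a p c q \<longrightarrow> linked E p q (25/4 * dist p q)) \<and>
     (\<forall>y u. crossing V E lx ly p y u q \<longrightarrow> X u - X p \<le> Y u - Y p \<longrightarrow>
        linked E p q (25/4 * dist p q)))"

text \<open>Origin \<open>x\<close>; the points are \<open>u = (p, q)\<close>,
  \<open>v = (v1, -v2)\<close>, \<open>t = (tx, -ty)\<close>, \<open>t' = (t1, t2)\<close> and
  \<open>y = (y1, y2)\<close>. Minimality of \<open>u \<rightarrow> v\<close> gives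
  \<open>t1 + t2 \<le> p \<le> y1\<close>, whereas minimality of \<open>x \<rightarrow> y\<close>
  makes \<open>t'\<close> at least as far from \<open>x\<close> as \<open>y\<close>. Only the
  degenerate case of equality survives.\<close>

lemma no_left_exit_low:
  fixes p q v1 v2 tx ty t1 t2 y1 y2 :: real
  assumes "0 \<le> v1" "v1 \<le> p" "p \<le> q" "0 \<le> v2" "0 \<le> ty" "0 \<le> t1" "t1 \<le> p" "0 \<le> t2" "t2 \<le> q" "p \<le> y1"
    and t: "(tx - t1)\<^sup>2 + (ty + t2)\<^sup>2 \<le> tx\<^sup>2 + ty\<^sup>2"
    and y: "y1\<^sup>2 + y2\<^sup>2 \<le> t1\<^sup>2 + t2\<^sup>2"
    and v: "(p - v1)\<^sup>2 + (q + v2)\<^sup>2 \<le> (p - t1)\<^sup>2 + (q - t2)\<^sup>2"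
  shows "t1 = y1 \<and> t2 = y2"
proof -
  have "t2\<^sup>2 \<le> (v2 + t2) * (2 * q + v2 - t2)"
    unfolding power2_eq_square using assms by (intro mult_mono) auto
  also have "\<dots> = (q + v2)\<^sup>2 - (q - t2)\<^sup>2" by (simp add: power2_eq_square algebra_simps)
  also have "\<dots> \<le> (p - t1)\<^sup>2" using v zero_le_power2[of "p - v1"] by linarith
  finally have "t2 \<le> p - t1" using assms by (auto intro: power2_le_imp_le)
  then have "(t1 + t2)\<^sup>2 \<le> y1\<^sup>2" using assms by (intro power_mono) auto
  moreover have "(t1 + t2)\<^sup>2 = t1\<^sup>2 + t2\<^sup>2 + 2 * (t1 * t2)" by (simp add: power2_sum)
  moreover have nn: "0 \<le> t1 * t2" using assms by simp
  ultimately have "t1 * t2 = 0" "y2\<^sup>2 = 0" "t1\<^sup>2 + t2\<^sup>2 = y1\<^sup>2"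
    using y zero_le_power2[of y2] by linarith+
  then have *: "t1 = 0 \<or> t2 = 0" "y2 = 0" "t1\<^sup>2 + t2\<^sup>2 = y1\<^sup>2" by auto
  have "t2 = 0"
  proof (cases "t1 = 0")
    case True
    have "0 \<le> ty * t2" using assms by simp
    moreover have "t2\<^sup>2 + 2 * (ty * t2) \<le> 0" using t True by (simp add: power2_sum)
    ultimately have "t2\<^sup>2 \<le> 0" by linarith
    then show ?thesis by simp
  qed (use * in auto)
  then show ?thesis using * assms power2_eq_iff_nonneg[of t1 y1] by auto
qed

text \<open>Minimality of \<open>t \<rightarrow> t'\<close> puts \<open>t'\<close> into the disc of
  radius \<open>p\<close> around \<open>(p, 0)\<close>. Its height is then at most
  \<open>p \<le> q\<close>, with equality only at \<open>(p, q)\<close>.\<close>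

lemma no_left_exit_high:
  fixes p q tx ty t1 t2 :: real
  assumes "tx \<le> p" "0 \<le> ty" "0 \<le> t1" "0 \<le> p" "p \<le> q" "q \<le> t2"
    and t: "(tx - t1)\<^sup>2 + (ty + t2)\<^sup>2 \<le> tx\<^sup>2 + ty\<^sup>2"
  shows "t1 = p \<and> t2 = q"
proof -
  have "0 \<le> ty * t2" "tx * t1 \<le> p * t1"
    using assms by (auto intro: mult_right_mono)
  then have *: "(t1 - p)\<^sup>2 + t2\<^sup>2 \<le> p\<^sup>2"
    using t by (simp add: power2_eq_square algebra_simps)
  then have "t2\<^sup>2 \<le> p\<^sup>2" using zero_le_power2[of "t1 - p"] by linarith
  then have "t2 \<le> p" using assms by (auto intro: power2_le_imp_le)
  then have "t2 = p" "t2 = q" using assms by auto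
  then show ?thesis using * by simp
qed

text \<open>Induction on real distances is well-founded here, since only finitely many pairs are
  available.\<close>

lemma pair_dist_induct [consumes 3, case_names less]:
  fixes P :: "point \<Rightarrow> point \<Rightarrow> bool"
  assumes "finite V" "p \<in> V" "q \<in> V"
    and step: "\<And>p q. p \<in> V \<Longrightarrow> q \<in> V \<Longrightarrow>
      (\<And>r s. r \<in> V \<Longrightarrow> s \<in> V \<Longrightarrow> dist r s < dist p q \<Longrightarrow> P r s) \<Longrightarrow> P p q"
  shows "P p q"
  using assms(2,3)
proof (induction "card {z \<in> V \<times> V. dist (fst z) (snd z) < dist p q}" arbitrary: p q rule: less_induct)
  case less
  show ?case
  proof (rule step[OF less.prems])
    fix r s assume rs: "r \<in> V" "s \<in> V" "dist r s < dist p q"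
    have "{z \<in> V \<times> V. dist (fst z) (snd z) < dist r s} \<subset> {z \<in> V \<times> V. dist (fst z) (snd z) < dist p q}"
    proof (rule psubsetI)
      show "{z \<in> V \<times> V. dist (fst z) (snd z) < dist r s} \<subseteq> {z \<in> V \<times> V. dist (fst z) (snd z) < dist p q}"
        using rs by auto
      have "(r, s) \<in> {z \<in> V \<times> V. dist (fst z) (snd z) < dist p q}"
        "(r, s) \<notin> {z \<in> V \<times> V. dist (fst z) (snd z) < dist r s}"
        using rs by auto
      then show "{z \<in> V \<times> V. dist (fst z) (snd z) < dist r s} \<noteq> {z \<in> V \<times> V. dist (fst z) (snd z) < dist p q}"
        by metis
    qed
    then have "card {z \<in> V \<times> V. dist (fst z) (snd z) < dist r s} <
        card {z \<in> V \<times> V. dist (fst z) (snd z) < dist p q}"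
      using assms(1) by (intro psubset_card_mono) auto
    then show "P r s" using less.hyps[of r s] rs by blast
  qed
qed

section \<open>Recursion on the short sides of intersections\<close>

context frame
begin

lemma frame_flip_y: "frame V E X (\<lambda>p. - Y p) lx (conversep ly)"
  by (rule frame_flipY[OF frame_axioms])

lemma frame_flip_x: "frame V E (\<lambda>p. - X p) Y (conversep lx) ly"
  by (rule frame_flipX[OF frame_axioms])

lemma frame_swap_xy: "frame V E Y X ly lx"
  by (rule frame_swap[OF frame_axioms])

lemma frame_antidiagonal: "frame V E (\<lambda>p. - Y p) (\<lambda>p. - X p) (conversep ly) (conversep lx)"
  by (intro frame_flipX frame_flipY frame_swap_xy)

lemma frame_rotate: "frame V E (\<lambda>p. - Y p) X (conversep ly) lx"
  by (intro frame_flipX frame_swap_xy)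

lemma dist_mono_box:
  assumes "X p \<le> X x" "X x \<le> X u" "X u \<le> X q" "Y p \<le> Y x" "Y x \<le> Y u" "Y u \<le> Y q"
  shows "dist x u \<le> dist p q" and "l1dist p x + l1dist x u + l1dist u q = l1dist p q"
proof -
  have "(X u - X x)\<^sup>2 \<le> (X q - X p)\<^sup>2" "(Y u - Y x)\<^sup>2 \<le> (Y q - Y p)\<^sup>2"
    using assms by (auto intro!: power_mono)
  then have "(dist x u)\<^sup>2 \<le> (dist p q)\<^sup>2" by (simp add: dist_sq power2_commute)
  then show "dist x u \<le> dist p q" by (rule power2_le_imp_le) simp
  show "l1dist p x + l1dist x u + l1dist u q = l1dist p q"
    using assms by (simp add: l1_XY)
qed

lemma box_coords:
  assumes "t \<in> span_box V lx ly p q"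
  shows "X p \<le> X t" "X t \<le> X q" "Y p \<le> Y t" "Y t \<le> Y q" "t \<in> V"
  using assms lx_X[of p t] lx_X[of t q] ly_Y[of p t] ly_Y[of t q] by (auto simp: span_box_def)

lemma goodD_hook: "good V E p q \<Longrightarrow> hook V E lx ly a p c q \<Longrightarrow> linked E p q (25/4 * dist p q)"
  using frame_axioms unfolding good_def by blast

lemma goodD_crossing:
  "good V E p q \<Longrightarrow> crossing V E lx ly p y u q \<Longrightarrow> X u - X p \<le> Y u - Y p \<Longrightarrow>
    linked E p q (25/4 * dist p q)"
  using frame_axioms unfolding good_def by blast

lemma linked_commute: "linked E p q L \<longleftrightarrow> linked E q p L"
  using linked_sym E_sym by metis

text \<open>Go from \<open>p\<close> to \<open>x\<close>, along the short side and one crossing edge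
  to \<open>u\<close>, then on to \<open>q\<close>. The edge and the two monotone parts together
  cost at most \<open>l1dist p q\<close>, and the short side is shorter than \<open>dist p q\<close>
  by the factor \<open>77/100\<close>, which leaves room for the L1 distance in
  \<open>25/4\<close>.\<close>

lemma join_crossing:
  assumes cr: "crossing V E lx ly x y u v"
    and x: "x \<in> span_box V lx ly p q" "linked E p x (l1dist p x)"
    and u: "u \<in> span_box V lx ly p q" "linked E u q (l1dist u q)"
    and IH: "\<And>r s. r \<in> V \<Longrightarrow> s \<in> V \<Longrightarrow> dist r s < dist p q \<Longrightarrow> good V E r s"
  shows "linked E p q (25/4 * dist p q)"
proof -
  note cf = crossing_facts[OF cr]
  note xc = box_coords[OF x(1)] and uc = box_coords[OF u(1)]
  have xu: "X x \<le> X u" "Y x \<le> Y u" using cf lx_X ly_Y by blast+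
  note m = dist_mono_box[OF xc(1) xu(1) uc(2) xc(3) xu(2) uc(4)]
  have pos: "0 < dist x u" using cf(11) by auto
  have tot: "l1dist p x + (dist x u + 25/4 * d) + l1dist u q \<le> 25/4 * dist p q"
    if "d \<le> 77/100 * dist x u" for d
    using that m dist_le_l1dist[of x u] l1dist_le[of p q] zero_le_dist[of p q] by argo
  show ?thesis
  proof (cases "X u - X x \<le> Y u - Y x")
    case True
    note d = crossing_dist(1)[OF cr True]
    have "good V E x v" using IH[of x v] cf d pos m(1) by auto
    then have "linked E x v (25/4 * dist x v)" using goodD_crossing cr True by blast
    moreover have "linked E v u (dist x u)"
      using linked_edge[of E u v "dist x u"] cf by (simp add: linked_commute)
    ultimately have "linked E x u (25/4 * dist x v + dist x u)" by (rule linked_trans)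
    then show ?thesis
      by (rule linked_join[OF x(2) _ u(2)]) (use tot[OF d] in simp)
  next
    case False
    interpret ad: frame V E "\<lambda>p. - Y p" "\<lambda>p. - X p" "conversep ly" "conversep lx"
      by (rule frame_antidiagonal)
    note cr' = crossing_antidiagonal[OF cr]
    have le: "- Y x - - Y u \<le> - X x - - X u" using False by simp
    have d: "dist u y \<le> 77/100 * dist x u"
      using ad.crossing_dist(1)[OF cr' le] by (simp add: dist_commute)
    have "good V E u y" using IH[of u y] cf d pos m(1) by auto
    then have "linked E u y (25/4 * dist u y)" using ad.goodD_crossing cr' le by blast
    then have "linked E y u (25/4 * dist u y)" by (simp add: linked_commute)
    with linked_edge[of E x y "dist x u"] cf have "linked E x u (dist x u + 25/4 * dist u y)"
      using linked_trans by blast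
    then show ?thesis
      by (rule linked_join[OF x(2) _ u(2)]) (use tot[OF d] in simp)
  qed
qed

text \<open>The budget closes because \<open>sqrt 2 + 25/4 * 3/4 \<le> 25/4\<close>.\<close>

lemma join_exit:
  assumes t: "t \<in> span_box V lx ly p q" "t \<noteq> q" "linked E p t (l1dist p t)" "nearest V E lx ly t t'"
    and qV: "q \<in> V" and l: "linked E t' q (25/4 * dist t' q)" and d: "dist t' q \<le> 3/4 * dist p q"
  shows "linked E p q (25/4 * dist p q)"
proof -
  have e: "E t t'" "dist t t' \<le> dist t q"
    using t qV by (auto simp: nearest_def span_box_def)
  show ?thesis
  proof (rule linked_join[OF t(3) linked_edge[where E = E, OF e] l])
    have "l1dist p t + dist t q \<le> l1dist p q"
      using l1dist_box_add[OF t(1)] dist_le_l1dist[of t q] by simp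
    then show "l1dist p t + dist t q + 25/4 * dist t' q \<le> 25/4 * dist p q"
      using d l1dist_le[of p q] zero_le_dist[of p q] by argo
  qed
qed

text \<open>Such a \<open>t'\<close> would compete with \<open>d\<close> for the edge leaving
  \<open>c\<close>, while \<open>d\<close> competes with \<open>t'\<close> for the edge leaving
  \<open>t\<close>. The two minimality conditions pull in opposite directions.\<close>

lemma hook_no_left_exit:
  assumes h: "hook V E lx ly a b c d"
    and t: "t \<in> span_box V lx (conversep ly) d b" "t \<noteq> d"
    and t': "nearest V E (conversep lx) ly t t'" "lx t' d"
  shows "\<not> ly t' d"
proof
  assume t'd: "ly t' d"
  note hf = hook_facts[OF h]
  have cd: "nearest V E (conversep lx) ly c d" using h by (simp add: hook_def)
  have td: "lx d t" "ly t d" and tV: "t \<in> V" and tb: "t = b \<or> ly b t"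
    using t by (auto simp: span_box_def)
  have tt': "lx t' t" "ly t t'" "t' \<in> V" using t' by (auto simp: nearest_def)
  have "ly c b" using hf ly_trans by blast
  then have ct: "ly c t" using tb ly_trans by blast
  then have ct': "ly c t'" "lx t' c" using tt' t' hf ly_trans lx_trans by blast+
  have le1: "dist c d \<le> dist c t'" using nearest_le[OF cd] tt' ct' by auto
  have le2: "dist t t' \<le> dist t d" using nearest_le[OF t'(1)] hf td by auto
  have cV: "c \<in> V" and dc: "lx d c" using hf by auto
  interpret fl: frame V E "\<lambda>p. - X p" Y "conversep lx" ly by (rule frame_flip_x)
  have "lx c t"
  proof (rule ccontr)
    assume "\<not> lx c t"
    moreover have "t \<noteq> c" using ct by auto
    ultimately have "lx t c" using not_lx_iff[of c t] by auto
    then have "dist c t < dist c d" "dist c d \<le> dist c t"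
      using fl.dist_less_NE[of c t d] nearest_le[OF cd tV] ct td by auto
    then show False by simp
  qed
  then have o: "0 \<le> X t - X c" "0 \<le> Y t - Y c" "0 \<le> X d - X t'" "0 \<le> Y d - Y t'"
    using ct t'(2) t'd lx_X[of c t] ly_Y[of c t] lx_X[of t' d] ly_Y[of t' d] by auto
  have "(dist c d)\<^sup>2 \<le> (dist c t')\<^sup>2" "(dist t t')\<^sup>2 \<le> (dist t d)\<^sup>2"
    using le1 le2 by (auto intro: power_mono)
  \<comment> \<open>The sum of both squared inequalities is a condition on the inner product of
    \<open>d - t'\<close> and \<open>t - c\<close>. Both vectors have nonnegative coordinates, so
    both products vanish; the rest excludes this degenerate case by showing
    \<open>t = c\<close>.\<close>
  then have "(X d - X t') * (X t - X c) + (Y d - Y t') * (Y t - Y c) \<le> 0"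
    unfolding dist_sq by (simp add: power2_eq_square algebra_simps)
  moreover have "0 \<le> (X d - X t') * (X t - X c)" "0 \<le> (Y d - Y t') * (Y t - Y c)"
    using o by (auto intro: mult_nonneg_nonneg)
  ultimately have z: "(X d - X t') * (X t - X c) = 0" "(Y d - Y t') * (Y t - Y c) = 0"
    by linarith+
  have ne: "t' \<noteq> d" using t' by auto
  have cs: "Y c \<le> Y t'" "X t' \<le> X c" "Y t \<le> Y t'" "X t' \<le> X t" "X d \<le> X t" "Y t \<le> Y d"
    using ct' tt' td lx_X ly_Y by blast+
  have "X d \<noteq> X t'"
    using fl.dist_less_if_between[of c t' d] le1 cs o ne by auto
  then have "X t = X c" using z by auto
  moreover have "Y d \<noteq> Y t'"
    using fl.dist_less_if_between[of t d t'] le2 cs o ne by auto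
  then have "Y t = Y c" using z by auto
  ultimately have "t = c" by (rule eq_if_coords_eq)
  then show False using ct by auto
qed

text \<open>Paths between \<open>d\<close> and \<open>b\<close> cannot leave on the side of
  \<open>d\<close>. Leaving below \<open>b\<close> produces a hook, rotated by a right angle,
  between the leaving edge and \<open>a \<rightarrow> b\<close>; its short side is shorter than
  \<open>dist b d\<close> by the factor \<open>3/4\<close>.\<close>

lemma hook_step:
  assumes h: "hook V E lx ly a b c d"
    and IH: "\<And>r s. r \<in> V \<Longrightarrow> s \<in> V \<Longrightarrow> dist r s < dist b d \<Longrightarrow> good V E r s"
  shows "linked E b d (25/4 * dist b d)"
proof -
  note hf = hook_facts[OF h]
  interpret fl: frame V E X "\<lambda>p. - Y p" lx "conversep ly" by (rule frame_flip_y)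
  have pos: "0 < dist b d" using hf(10) by auto
  have IH': "good V E r s" if "r \<in> V" "s \<in> V" "dist r s < dist d b" for r s
    using IH that by (simp add: dist_commute)
  have "linked E d b (25/4 * dist d b)"
    using hf(9) hf(7) hf(10)
  proof (rule fl.path_cases)
    show "conversep ly d b" using hf by simp
    assume "linked E d b (l1dist d b)"
    then show ?thesis
      by (rule linked_mono) (use l1dist_le[of d b] zero_le_dist[of d b] in argo)
  next
    fix x y u v
    assume "x \<in> span_box V lx (conversep ly) d b" "u \<in> span_box V lx (conversep ly) d b"
      "linked E d x (l1dist d x)" "linked E u b (l1dist u b)" "crossing V E lx (conversep ly) x y u v"
    then show ?thesis using fl.join_crossing[of x y u v d b] IH' by blast
  next
    fix t t'
    assume t: "t \<in> span_box V lx (conversep ly) d b" "t \<noteq> b" "linked E d t (l1dist d t)"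
      "nearest V E lx (conversep ly) t t'" and "lx t' b" "conversep ly b t'"
    then have t'b: "lx t' b" "ly t' b" by auto
    have tt': "lx t t'" "ly t' t" "t' \<in> V" "t \<in> V" using t by (auto simp: nearest_def span_box_def)
    have tb: "lx t b" "ly b t" using t by (auto simp: span_box_def)
    have ad: "lx a d" using h by (simp add: hook_def)
    have at: "lx a t" using t ad lx_trans[of a d t] by (auto simp: span_box_def)
    then have at': "lx a t'" using tt' lx_trans by blast
    \<comment> \<open>Above \<open>a\<close>, the point \<open>t'\<close> would be a nearer
      neighbour of \<open>a\<close> than \<open>b\<close> in the same quadrant.\<close>
    have "ly t' a"
    proof (rule ccontr)
      assume "\<not> ly t' a"
      moreover have "t' \<noteq> a" using at' by auto
      ultimately have "ly a t'" using not_ly_iff[of t' a] by auto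
      then have "dist a t' < dist a b" "dist a b \<le> dist a t'"
        using dist_less_NE[of a t' b] at' t'b h tt' by (auto simp: hook_def nearest_def)
      then show False by simp
    qed
    then have h': "hook V E (conversep ly) lx t t' a b"
      using t h tb at tt' hf by (simp add: hook_def nearest_swap)
    interpret r: frame V E "\<lambda>p. - Y p" X "conversep ly" lx by (rule frame_rotate)
    note hf' = r.hook_facts[OF h']
    note tc = fl.box_coords[OF t(1)]
    have tbd: "dist t b \<le> dist b d"
      using fl.dist_mono_box(1)[of d t b b] tc by (simp add: dist_commute)
    have "(dist t' b)\<^sup>2 \<le> (dist b d)\<^sup>2 - 2 * (X t - X a) * (X b - X t)"
      using hf'(1) power_mono[OF tbd zero_le_dist, of 2] by linarith
    \<comment> \<open>The premise \<open>R \<le> 2 * q\<close> of \<open>hook_contraction\<close>;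
      it carries over from \<open>d\<close> to \<open>t\<close> because \<open>t\<close> is not to
      the left of \<open>d\<close>.\<close>
    moreover have "dist b d \<le> 2 * (X t - X a)" using hf(3,5) tc by simp
    ultimately have m: "dist t' b \<le> 3/4 * dist b d"
      using hf'(2) tc pos by (intro hook_contraction[where q = "X t - X a" and d = "X b - X t"]) auto
    then have "good V E t' b" using IH[of t' b] pos tt' hf by auto
    then have "linked E t' b (25/4 * dist t' b)" using r.goodD_hook h' by blast
    then show ?thesis
      using fl.join_exit[OF t] hf m by (simp add: dist_commute)
  next
    fix t t'
    assume "t \<in> span_box V lx (conversep ly) d b" "t \<noteq> d"
      "nearest V E (conversep lx) (conversep (conversep ly)) t t'" "lx t' d" "conversep ly d t'"
    then show ?thesis using hook_no_left_exit[OF h] by simp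
  qed
  then show ?thesis by (simp add: dist_commute linked_commute)
qed

text \<open>A target \<open>t'\<close> below \<open>u\<close> competes with both \<open>y\<close>
  and \<open>v\<close>, and \<open>no_left_exit_low\<close> would identify it with \<open>y\<close>.
  A higher one would have to be \<open>u\<close> itself. Both contradict \<open>t'\<close> being to
  the left of \<open>u\<close>.\<close>

lemma crossing_no_left_exit:
  assumes cr: "crossing V E lx ly x y u v" and le: "X u - X x \<le> Y u - Y x"
    and t: "t \<in> span_box V (conversep ly) lx x v" "t \<noteq> x"
    and t': "nearest V E (conversep lx) ly t t'" "ly x t'"
  shows "\<not> lx x t'"
proof
  assume xt': "lx x t'"
  note cf = crossing_facts[OF cr]
  have xy: "nearest V E lx ly x y" and uv: "nearest V E (conversep lx) (conversep ly) u v"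
    using cr by (auto simp: crossing_def)
  have xt: "lx x t" "ly t x" and tv: "t = v \<or> lx t v \<and> ly v t" and tV: "t \<in> V"
    using t by (auto simp: span_box_def)
  have tt': "lx t' t" "ly t t'" "t' \<in> V" using t' by (auto simp: nearest_def)
  have t'u: "lx t' u" using tt' tv cf(6) lx_trans by blast
  have "dist t t' \<le> dist t x" "dist x y \<le> dist x t'"
    using nearest_le[OF t'(1), of x] nearest_le[OF xy, of t'] xt tt' cf t' xt' by auto
  then have "(dist t t')\<^sup>2 \<le> (dist t x)\<^sup>2" "(dist x y)\<^sup>2 \<le> (dist x t')\<^sup>2"
    by (auto intro: power_mono)
  then have e: "((X t - X x) - (X t' - X x))\<^sup>2 + ((Y x - Y t) + (Y t' - Y x))\<^sup>2 \<le> (X t - X x)\<^sup>2 + (Y x - Y t)\<^sup>2"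
    "(X y - X x)\<^sup>2 + (Y y - Y x)\<^sup>2 \<le> (X t' - X x)\<^sup>2 + (Y t' - Y x)\<^sup>2"
    by (simp_all add: dist_sq power2_commute)
  have o: "0 \<le> X v - X x" "X v - X x \<le> X u - X x" "0 \<le> Y x - Y v" "0 \<le> Y x - Y t"
    "0 \<le> X t' - X x" "X t' - X x \<le> X u - X x" "0 \<le> Y t' - Y x" "X u - X x \<le> X y - X x"
    "X t - X x \<le> X v - X x"
    using lx_X[of x v] lx_X[of v u] ly_Y[of v x] ly_Y[of t x] lx_X[of x t'] lx_X[of t' u]
      ly_Y[of x t'] lx_X[of u y] lx_X[of t v] cf xt xt' t' t'u tv by auto
  show False
  proof (cases "ly t' u")
    case True
    have "dist u v \<le> dist u t'" using nearest_le[OF uv] tt' t'u True by auto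
    then have "(dist u v)\<^sup>2 \<le> (dist u t')\<^sup>2" by (auto intro: power_mono)
    then have e3: "((X u - X x) - (X v - X x))\<^sup>2 + ((Y u - Y x) + (Y x - Y v))\<^sup>2
        \<le> ((X u - X x) - (X t' - X x))\<^sup>2 + ((Y u - Y x) - (Y t' - Y x))\<^sup>2"
      by (simp add: dist_sq)
    have "Y t' - Y x \<le> Y u - Y x" using ly_Y[OF True] by simp
    then have "X t' - X x = X y - X x \<and> Y t' - Y x = Y y - Y x"
      by (rule no_left_exit_low[OF o(1,2) le o(3-7) _ o(8) e e3])
    then have "t' = y" by (intro eq_if_coords_eq) auto
    then show False using t'u cf(7) lx_asym by blast
  next
    case False
    then have "Y u - Y x \<le> Y t' - Y x" using ly_if_less[of t' u] by linarith
    then have "X t' - X x = X u - X x \<and> Y t' - Y x = Y u - Y x"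
      using o by (intro no_left_exit_high[OF _ o(4,5) _ le _ e(1)]) auto
    then have "t' = u" by (intro eq_if_coords_eq) auto
    then show False using t'u by auto
  qed
qed

text \<open>The box of \<open>x\<close> and \<open>v\<close> can be left only beyond
  \<open>v\<close>, and the leaving edge \<open>s \<rightarrow> w\<close> then forms a hook with
  \<open>u \<rightarrow> v\<close>. So crossings reduce to crossings or hooks with a smaller short
  side.\<close>

lemma crossing_step:
  assumes cr: "crossing V E lx ly x y u v" and le: "X u - X x \<le> Y u - Y x"
    and IH: "\<And>r s. r \<in> V \<Longrightarrow> s \<in> V \<Longrightarrow> dist r s < dist x v \<Longrightarrow> good V E r s"
  shows "linked E x v (25/4 * dist x v)"
proof -
  note cf = crossing_facts[OF cr]
  interpret r: frame V E "\<lambda>p. - Y p" X "conversep ly" lx by (rule frame_rotate)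
  have pos: "0 < dist x v" using cf(5) by auto
  show ?thesis
    using cf(1) cf(4)
  proof (rule r.path_cases)
    show "conversep ly x v" "lx x v" using cf by simp_all
    assume "linked E x v (l1dist x v)"
    then show ?thesis
      by (rule linked_mono) (use l1dist_le[of x v] zero_le_dist[of x v] in argo)
  next
    fix x' y' u' v'
    assume "x' \<in> span_box V (conversep ly) lx x v" "u' \<in> span_box V (conversep ly) lx x v"
      "linked E x x' (l1dist x x')" "linked E u' v (l1dist u' v)" "crossing V E (conversep ly) lx x' y' u' v'"
    then show ?thesis using r.join_crossing[of x' y' u' v' x v] IH by blast
  next
    fix s w
    assume s: "s \<in> span_box V (conversep ly) lx x v" "s \<noteq> v" "linked E x s (l1dist x s)"
      "nearest V E (conversep ly) lx s w" and "conversep ly w v" "lx v w"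
    then have vw: "ly v w" "lx v w" by auto
    have sw: "ly w s" "lx s w" "w \<in> V" "s \<in> V" using s by (auto simp: nearest_def span_box_def)
    have sv: "lx s v" "ly v s" using s by (auto simp: span_box_def)
    have su: "ly s u" using s cf(12) ly_trans[of s x u] by (auto simp: span_box_def)
    then have wu: "ly w u" using sw ly_trans by blast
    have "lx u w"
    proof (rule ccontr)
      assume "\<not> lx u w"
      moreover have "w \<noteq> u" using wu by auto
      ultimately have "lx w u" using not_lx_iff[of u w] by auto
      then have "dist u w < dist u v" "dist u v \<le> dist u w"
        using dist_less_SW[of w u v] wu vw cr sw by (auto simp: crossing_def nearest_def)
      then show False by simp
    qed
    then have h: "hook V E lx (conversep ly) s w u v"
      using s cr sv su sw cf by (simp add: hook_def nearest_swap crossing_def)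
    interpret fl: frame V E X "\<lambda>p. - Y p" lx "conversep ly" by (rule frame_flip_y)
    note hf = fl.hook_facts[OF h]
    note sc = r.box_coords[OF s(1)]
    have svd: "dist s v \<le> dist x v"
      using r.dist_mono_box(1)[of x s v v] sc by simp
    have "(dist w v)\<^sup>2 \<le> (dist x v)\<^sup>2 - 2 * (Y u - Y s) * (Y s - Y v)"
    proof -
      have "(dist w v)\<^sup>2 \<le> (dist s v)\<^sup>2 - 2 * (Y u - Y s) * (Y s - Y v)"
        using hf(1) by simp
      then show ?thesis using power_mono[OF svd zero_le_dist, of 2] by linarith
    qed
    \<comment> \<open>Uses \<open>121/100 \<le> 4\<close>, the assumption that the crossing is tall,
      and that \<open>s\<close> is not above \<open>x\<close>.\<close>
    moreover have "dist x v \<le> 2 * (Y u - Y s)"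
    proof -
      have p: "0 \<le> X u - X x" using cf lx_X[of x u] by simp
      have "(dist x v)\<^sup>2 \<le> (2 * (X u - X x))\<^sup>2"
        using crossing_dist(2)[OF cr le] zero_le_power2[of "X u - X x"]
        unfolding power_mult_distrib power2_eq_square[of "2::real"] by linarith
      then have "dist x v \<le> 2 * (X u - X x)" by (rule power2_le_imp_le) (use p in simp)
      then show ?thesis using le sc by simp
    qed
    ultimately have m: "dist w v \<le> 3/4 * dist x v"
      using hf(2) sc pos by (intro hook_contraction[where q = "Y u - Y s" and d = "Y s - Y v"]) auto
    then have "good V E w v" using IH[of w v] pos sw cf by auto
    then have "linked E w v (25/4 * dist w v)" using fl.goodD_hook h by blast
    then show ?thesis
      using r.join_exit[OF s] cf m by simp
  next
    fix t t'
    assume "t \<in> span_box V (conversep ly) lx x v" "t \<noteq> x"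
      "nearest V E (conversep (conversep ly)) (conversep lx) t t'" "conversep ly t' x" "lx x t'"
    then show ?thesis using crossing_no_left_exit[OF cr le] by (simp add: nearest_swap)
  qed
qed

end

lemma good_all:
  assumes "frame V E X Y lx ly" "p \<in> V" "q \<in> V"
  shows "good V E p q"
  using frame.finV[OF assms(1)] assms(2,3)
proof (induction rule: pair_dist_induct)
  case (less p q)
  show ?case
    unfolding good_def[of V E p q]
  proof (intro allI impI conjI)
    fix X Y lx ly
    assume fr: "frame V E X Y lx ly"
    show "linked E p q (25/4 * dist p q)" if "hook V E lx ly a p c q" for a c
      by (rule frame.hook_step[OF fr that less(3)])
    show "linked E p q (25/4 * dist p q)"
      if "crossing V E lx ly p y u q" "X u - X p \<le> Y u - Y p" for y u
      by (rule frame.crossing_step[OF fr that less(3)])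
  qed
qed

section \<open>Empty squares\<close>

text \<open>Intended for a hook with long side \<open>r\<close>, whose legs are \<open>D\<close> and
  \<open>y\<close>, and short side \<open>m\<close>. The constants round up \<open>sqrt 2\<close>
  and \<open>2 / sqrt 3\<close>.\<close>

lemma short_leg_bound:
  fixes p y D r m :: real
  assumes r: "r\<^sup>2 = D\<^sup>2 + y\<^sup>2" "r\<^sup>2 \<le> 2 * p * y" and m: "3 * m\<^sup>2 \<le> 4 * D\<^sup>2"
    and "0 \<le> D" "0 \<le> y" "y \<le> p"
  shows "D \<le> p" "r \<le> 70711/50000 * p" "m \<le> 1155/1000 * D"
proof -
  have "0 \<le> (p - y)\<^sup>2" by simp
  then have "D\<^sup>2 \<le> p\<^sup>2" using r by (simp add: power2_diff)
  then show "D \<le> p" using assms by (auto intro: power2_le_imp_le)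
  have "p * y \<le> p\<^sup>2" unfolding power2_eq_square using assms by (intro mult_left_mono) auto
  then have "r\<^sup>2 \<le> 2 * p\<^sup>2" using r by simp
  also have "\<dots> \<le> (70711/50000 * p)\<^sup>2"
    unfolding power_mult_distrib by (intro mult_right_mono) (auto simp: power_divide)
  finally show "r \<le> 70711/50000 * p" by (rule power2_le_imp_le) (use assms in simp)
  have "m\<^sup>2 \<le> 4/3 * D\<^sup>2" using m by simp
  also have "\<dots> \<le> (1155/1000 * D)\<^sup>2"
    unfolding power_mult_distrib by (intro mult_right_mono) (auto simp: power_divide)
  finally show "m \<le> 1155/1000 * D" by (rule power2_le_imp_le) (use assms in simp)
qed

context frame
begin

lemma hook_linked: "hook V E lx ly a b c d \<Longrightarrow> linked E b d (25/4 * dist b d)"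
  using goodD_hook good_all[OF frame_axioms] hook_facts(7,9) by blast

text \<open>\<open>path_cases\<close> with crossings already resolved by \<open>good_all\<close>;
  only the two exits remain to be treated.\<close>

lemma linked_or_exit:
  assumes pV: "p \<in> V" and qV: "q \<in> V" and pq: "lx p q" "ly p q"
  obtains
    (linked) "linked E p q (25/4 * dist p q)"
  | (top) t t' where "t \<in> span_box V lx ly p q" "t \<noteq> q" "linked E p t (l1dist p t)"
      "nearest V E lx ly t t'" "lx t' q" "ly q t'"
  | (left) t t' where "t \<in> span_box V lx ly p q" "t \<noteq> p" "linked E t q (l1dist t q)"
      "nearest V E (conversep lx) (conversep ly) t t'" "lx t' p" "ly p t'"
proof (rule path_cases[OF assms])
  assume "linked E p q (l1dist p q)"
  moreover have "l1dist p q \<le> 25/4 * dist p q"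
    using l1dist_le[of p q] zero_le_dist[of p q] by argo
  ultimately show thesis by (intro linked) (rule linked_mono)
next
  fix x y u v
  assume "x \<in> span_box V lx ly p q" "u \<in> span_box V lx ly p q"
    "linked E p x (l1dist p x)" "linked E u q (l1dist u q)" "crossing V E lx ly x y u v"
  then show thesis using linked join_crossing good_all[OF frame_axioms] by blast
qed (use top left in blast)+

lemma coord_le_dist: "\<bar>X p - X q\<bar> \<le> dist p q" "\<bar>Y p - Y q\<bar> \<le> dist p q"
  unfolding dist_XY by (rule real_le_rsqrt; simp)+

end

definition empty_square :: "point set \<Rightarrow> (point \<Rightarrow> real) \<Rightarrow> (point \<Rightarrow> real) \<Rightarrow> real \<Rightarrow> real \<Rightarrow> real \<Rightarrow> bool" where
  "empty_square V X Y x y m \<longleftrightarrow> (\<forall>v\<in>V. \<not> (x < X v \<and> X v < x + m \<and> y < Y v \<and> Y v < y + m))"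

lemma empty_square_mono:
  "empty_square V X Y x y m \<Longrightarrow> x \<le> x' \<Longrightarrow> x' + m' \<le> x + m \<Longrightarrow> y \<le> y' \<Longrightarrow> y' + m' \<le> y + m \<Longrightarrow>
    empty_square V X Y x' y' m'"
  unfolding empty_square_def by force

lemma empty_square_swap: "empty_square V X Y x y m \<longleftrightarrow> empty_square V Y X y x m"
  by (auto simp: empty_square_def)

lemma empty_square_flip_x:
  "empty_square V X Y x y m \<longleftrightarrow> empty_square V (\<lambda>p. - X p) Y (- x - m) y m"
  unfolding empty_square_def by (rule ball_cong[OF refl]) auto

lemma empty_square_flip_y:
  "empty_square V X Y x y m \<longleftrightarrow> empty_square V X (\<lambda>p. - Y p) x (- y - m) m"
  unfolding empty_square_def by (rule ball_cong[OF refl]) auto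

text \<open>Here \<open>p\<close> is a corner of the empty square and \<open>q\<close> lies on one
  of the two sides away from it. As in \<open>good\<close>, the quantifier over frames makes all
  reflections available to the induction.\<close>

definition corner_good :: "point set \<Rightarrow> (point \<Rightarrow> point \<Rightarrow> bool) \<Rightarrow> point \<Rightarrow> point \<Rightarrow> bool" where
  "corner_good V E p q \<longleftrightarrow> (\<forall>X Y lx ly m. frame V E X Y lx ly \<longrightarrow> lx p q \<longrightarrow> ly p q \<longrightarrow>
     m = max (X q - X p) (Y q - Y p) \<longrightarrow> empty_square V X Y (X p) (Y p) m \<longrightarrow>
     linked E p q (l1dist p q + 89/10 * m))"

context frame
begin

lemma corner_goodD:
  assumes "corner_good V E p q" "lx p q" "ly p q" "empty_square V X Y (X p) (Y p) m"
    "max (X q - X p) (Y q - Y p) \<le> m"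
  shows "linked E p q (l1dist p q + 89/10 * max (X q - X p) (Y q - Y p))"
proof -
  have "empty_square V X Y (X p) (Y p) (max (X q - X p) (Y q - Y p))"
    by (rule empty_square_mono[OF assms(4)]) (use assms(5) in auto)
  then show ?thesis using assms frame_axioms unfolding corner_good_def by blast
qed

section \<open>The corner case: the Yao edge from \<open>b\<close> towards the corner
  \<open>a\<close>, by position of its target \<open>b1\<close>\<close>

context
  fixes a b b1 :: point and w k :: real
  assumes aV: "a \<in> V" and bV: "b \<in> V" and ab: "lx a b" "ly a b"
    and w: "w = X b - X a" and k: "k = Y b - Y a" and wk: "w \<le> k"
    and square: "empty_square V X Y (X a) (Y a) k"
    and IH: "\<And>r s. r \<in> V \<Longrightarrow> s \<in> V \<Longrightarrow> dist r s < dist a b \<Longrightarrow> corner_good V E r s"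
    and b1: "nearest V E (conversep lx) (conversep ly) b b1"
begin

lemma b1_facts: "b1 \<in> V" "lx b1 b" "ly b1 b" "linked E b b1 (dist b b1)" "linked E b1 b (dist b b1)"
  "dist b b1 \<le> dist a b" "0 \<le> w" "0 < k" "l1dist a b = w + k"
proof -
  show f: "b1 \<in> V" "lx b1 b" "ly b1 b" using b1 by (auto simp: nearest_def)
  show "linked E b b1 (dist b b1)" using b1 by (intro linked_edge) (auto simp: nearest_def)
  then show "linked E b1 b (dist b b1)" by (simp add: linked_commute)
  show "dist b b1 \<le> dist a b" using nearest_le[OF b1 aV] ab by (simp add: dist_commute)
  show w0: "0 \<le> w" using lx_X[OF ab(1)] w by simp
  have "k \<noteq> 0"
  proof
    assume "k = 0"
    then have "a = b" using wk w0 w k by (intro eq_if_coords_eq) auto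
    then show False using ab by simp
  qed
  then show "0 < k" using w0 wk by simp
  then show "l1dist a b = w + k" using w0 w k by (simp add: l1_XY)
qed

text \<open>The square spanned from \<open>a\<close> to \<open>b1\<close> is part of the given one,
  so the induction hypothesis applies, and the L1 distances add up.\<close>

lemma corner_inside:
  assumes "lx a b1" "ly a b1"
  shows "linked E a b (l1dist a b + 89/10 * k)"
proof -
  note bf = b1_facts
  have "dist a b1 < dist a b" using dist_less_NE[of a b1 b] assms bf by auto
  then have cg: "corner_good V E a b1" using IH aV bf by blast
  have m: "max (X b1 - X a) (Y b1 - Y a) \<le> k"
    using lx_X[OF bf(2)] ly_Y[OF bf(3)] w k wk by auto
  have "linked E a b1 (l1dist a b1 + 89/10 * max (X b1 - X a) (Y b1 - Y a))"
    by (rule corner_goodD[OF cg assms square m])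
  from linked_trans[OF this bf(5)] show ?thesis
  proof (rule linked_mono)
    have "l1dist a b1 + l1dist b b1 = l1dist a b"
      using l1dist_NE_add[of a b1 b] assms bf by (simp add: l1dist_commute)
    then show "l1dist a b1 + 89/10 * max (X b1 - X a) (Y b1 - Y a) + dist b b1 \<le> l1dist a b + 89/10 * k"
      using m dist_le_l1dist[of b b1] by argo
  qed
qed

text \<open>The points \<open>a\<close>, \<open>b\<close>, \<open>b1\<close> satisfy the hypotheses
  of \<open>crossing_bounds\<close>, so \<open>b1\<close> is close to \<open>a\<close>. If the path
  from \<open>b1\<close> leaves its box above \<open>a\<close>, emptiness puts the target at the
  height of \<open>a\<close>, where the induction hypothesis applies.\<close>

lemma corner_below:
  assumes ab1: "lx a b1" "ly b1 a"
  shows "linked E a b (l1dist a b + 89/10 * k)"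
proof -
  note bf = b1_facts
  have o: "0 \<le> X b1 - X a" "X b1 - X a \<le> w" "0 \<le> Y a - Y b1"
    using lx_X[OF ab1(1)] lx_X[OF bf(2)] ly_Y[OF ab1(2)] w by auto
  have "(dist b b1)\<^sup>2 \<le> (dist a b)\<^sup>2" using bf by (intro power_mono) auto
  then have "(w - (X b1 - X a))\<^sup>2 + (k + (Y a - Y b1))\<^sup>2 \<le> w\<^sup>2 + k\<^sup>2"
    by (simp add: dist_sq w k power2_commute)
  from crossing_bounds(2)[OF o(1,2) wk o(3) this]
  have "(dist a b1)\<^sup>2 \<le> (11/10 * w)\<^sup>2"
    by (simp add: dist_sq power2_commute power_mult_distrib power_divide)
  then have ab1w: "dist a b1 \<le> 11/10 * w" by (rule power2_le_imp_le) (use bf in simp)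
  \<comment> \<open>Suffices because \<open>11/10 * (sqrt 2 + 25/4) < 89/10\<close>, while the edge
    from \<open>b1\<close> to \<open>b\<close> is paid by \<open>l1dist a b\<close>.\<close>
  have fin: ?thesis if "linked E a b1 (l1dist a b1 + 25/4 * dist a b1)"
  proof (rule linked_mono[OF linked_trans[OF that bf(5)]])
    show "l1dist a b1 + 25/4 * dist a b1 + dist b b1 \<le> l1dist a b + 89/10 * k"
      using l1dist_le[of a b1] ab1w bf wk dist_le_l1dist[of a b] by argo
  qed
  interpret fl: frame V E "\<lambda>p. - X p" Y "conversep lx" ly by (rule frame_flip_x)
  show ?thesis
    using bf(1) aV
  proof (rule fl.linked_or_exit)
    show "conversep lx b1 a" "ly b1 a" using ab1 by auto
  next
    assume "linked E b1 a (25/4 * dist b1 a)"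
    then have "linked E a b1 (25/4 * dist a b1)" by (simp add: linked_commute dist_commute)
    moreover have "0 \<le> l1dist a b1" using dist_le_l1dist[of a b1] zero_le_dist[of a b1] by linarith
    ultimately have "linked E a b1 (l1dist a b1 + 25/4 * dist a b1)" by (simp add: linked_mono)
    then show ?thesis by (rule fin)
  next
    fix t t'
    assume t: "t \<in> span_box V (conversep lx) ly b1 a" "t \<noteq> a" "linked E b1 t (l1dist b1 t)"
      "nearest V E (conversep lx) ly t t'" and "conversep lx t' a" "ly a t'"
    then have t'a: "lx a t'" "ly a t'" by auto
    have tt': "lx t' t" "ly t t'" "t' \<in> V" "E t t'" using t by (auto simp: nearest_def)
    have ta: "lx a t" "ly t a" and tb1: "t = b1 \<or> lx t b1" using t by (auto simp: span_box_def)
    note tc = fl.box_coords[OF t(1)]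
    have t'b: "lx t' b" using tt' tb1 bf lx_trans by blast
    have "dist t t' \<le> dist t a" using nearest_le[OF t(4) aV] ta by auto
    then have "(dist t t')\<^sup>2 \<le> (dist t a)\<^sup>2" by (auto intro: power_mono)
    then have e: "((X t - X a) - (X t' - X a))\<^sup>2 + ((Y a - Y t) + (Y t' - Y a))\<^sup>2
        \<le> (X t - X a)\<^sup>2 + (Y a - Y t)\<^sup>2"
      by (simp add: dist_sq power2_commute)
    have o': "0 \<le> X t' - X a" "X t' \<le> X t" "0 \<le> Y t' - Y a"
      using lx_X[OF t'a(1)] lx_X[OF tt'(1)] ly_Y[OF t'a(2)] by auto
    have "Y t' - Y a < k"
    proof (rule ccontr)
      assume "\<not> ?thesis"
      then have "X t' - X a = w \<and> Y t' - Y a = k"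
        using o o' tc bf by (intro no_left_exit_high[OF _ _ _ _ wk _ e]) auto
      then have "t' = b" by (intro eq_if_coords_eq) (auto simp: w k)
      then show False using t'b by simp
    qed
    then have Yt'b: "Y t' < Y b" by (simp add: k)
    then have "dist b b1 \<le> dist b t'"
      using nearest_le[OF b1 tt'(3)] t'b ly_if_less[of t' b] by auto
    then have bt': "dist b b1 \<le> w - (X t' - X a) + (k - (Y t' - Y a))" "dist b b1 \<le> dist b t'"
      using dist_le_l1dist[of b t'] Yt'b lx_X[OF t'b] by (auto simp: l1_XY w k)
    \<comment> \<open>Strictly above the bottom side, \<open>t'\<close> would by emptiness lie on
      the vertical line through \<open>b\<close>, and then be nearer to \<open>b\<close> than
      \<open>b1\<close> is.\<close>
    have "Y t' = Y a"
    proof (rule ccontr)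
      assume "Y t' \<noteq> Y a"
      then have Y0: "0 < Y t' - Y a" using o' by simp
      have "X t' \<noteq> X a"
      proof
        assume "X t' = X a"
        then have "((Y a - Y t) + (Y t' - Y a))\<^sup>2 \<le> (Y a - Y t)\<^sup>2" using e by simp
        then have "(Y a - Y t) + (Y t' - Y a) \<le> Y a - Y t"
          by (rule power2_le_imp_le) (use tc in simp)
        then show False using Y0 by simp
      qed
      then have "X a < X t'" using o' by simp
      then have "\<not> X t' < X a + k"
        using square tt' Y0 Yt'b by (auto simp: empty_square_def k)
      then have "X t' = X b"
        using o o' tc wk lx_X[OF t'b] by (auto simp: w)
      then have "dist b t' = Y b - Y t'"
        using Yt'b by (simp add: dist_XY[of b t'])
      moreover have "Y b - Y b1 \<le> dist b b1" using coord_le_dist(2)[of b b1] by linarith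
      ultimately show False using bt'(2) Y0 o by simp
    qed
    then have X0: "X a < X t'" using eq_if_coords_eq[of a t'] o' t'a by force
    have "dist a t' < dist a b"
      by (rule dist_less_if_between) (use o' \<open>Y t' = Y a\<close> Yt'b lx_X[OF t'b] in auto)
    then have cg: "corner_good V E a t'" using IH aV tt' by blast
    have max: "max (X t' - X a) (Y t' - Y a) = X t' - X a" using X0 \<open>Y t' = Y a\<close> by simp
    have "linked E a t' (l1dist a t' + 89/10 * (X t' - X a))"
      using corner_goodD[OF cg t'a square] o o' tc wk unfolding max by auto
    moreover have "linked E t' t (dist t t')"
      using linked_edge[of E t t'] tt' by (simp add: linked_commute)
    moreover have "linked E t b (l1dist b1 t + dist b b1)"
      using linked_trans[of E t b1] t(3) bf(5) by (simp add: linked_commute)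
    ultimately show ?thesis
    proof (rule linked_join)
      have "Y b - Y b1 \<le> dist b b1" using coord_le_dist(2)[of b b1] by linarith
      moreover have "dist t t' \<le> l1dist t t'" by (rule dist_le_l1dist)
      moreover have "l1dist a t' = X t' - X a" "l1dist t t' = X t - X t' + (Y a - Y t)"
        "l1dist b1 t = X b1 - X t + (Y t - Y b1)"
        using o' tc X0 \<open>Y t' = Y a\<close> by (simp_all add: l1_XY)
      moreover have "X t' - X a \<le> w" using o o' tc by simp
      ultimately show "l1dist a t' + 89/10 * (X t' - X a) + dist t t' + (l1dist b1 t + dist b b1)
          \<le> l1dist a b + 89/10 * k"
        using bt'(1) o wk bf(9) \<open>Y t' = Y a\<close> k by argo
    qed
  next
    fix t t'
    assume t: "t \<in> span_box V (conversep lx) ly b1 a" "t \<noteq> b1" "linked E t a (l1dist t a)"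
      "nearest V E (conversep (conversep lx)) (conversep ly) t t'" "conversep lx t' b1" "ly b1 t'"
    have tt': "lx t t'" "ly t' t" "t' \<in> V" "E t t'" using t by (auto simp: nearest_def)
    have tb1: "lx t b1" "ly b1 t" and ta: "t = a \<or> ly t a" using t by (auto simp: span_box_def)
    note tc = fl.box_coords[OF t(1)]
    have tb: "ly t b" using ta ab ly_trans by blast
    then have t'b: "ly t' b" using tt' ly_trans by blast
    have "lx b t'"
    proof (rule ccontr)
      assume "\<not> lx b t'"
      moreover have "t' \<noteq> b" using t'b by auto
      ultimately have "lx t' b" using not_lx_iff[of b t'] by auto
      then have "dist b t' < dist b b1" "dist b b1 \<le> dist b t'"
        using dist_less_SW[of t' b b1] t'b t nearest_le[OF b1 tt'(3)] by auto
      then show False by simp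
    qed
    then have h: "hook V E lx (conversep ly) t t' b b1"
      using t b1 tb1 tb tc(5) bV by (simp add: hook_def)
    interpret fy: frame V E X "\<lambda>p. - Y p" lx "conversep ly" by (rule frame_flip_y)
    note hl = fy.hook_linked[OF h] and hf = fy.hook_facts[OF h]
    have "dist t t' \<le> dist t b1" using t tb1 bf by (auto simp: nearest_def)
    then have e: "linked E t t' (l1dist t b1)"
      using linked_edge[of E t t'] tt' dist_le_l1dist[of t b1] by auto
    have "dist t b1 \<le> dist a b1"
      using fl.dist_mono_box(1)[of b1 b1 t a] tc by (simp add: dist_commute)
    then have "dist t' b1 \<le> dist a b1" using hf(5) by simp
    moreover have "l1dist t a + l1dist t b1 = l1dist a b1"
      using fl.l1dist_box_add[OF t(1)] by (simp add: l1dist_commute)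
    ultimately have "linked E a b1 (l1dist a b1 + 25/4 * dist a b1)"
      using t(3) by (intro linked_join[OF _ e hl]) (auto simp: linked_commute)
    then show ?thesis by (rule fin)
  qed
qed

text \<open>The target overshoots \<open>a\<close> to the left by at most \<open>k\<close>, since
  \<open>dist b b1 \<le> dist a b \<le> w + k\<close>. An exit above \<open>b1\<close> gives a hook
  with \<open>b \<rightarrow> b1\<close>; an exit to the right of \<open>a\<close> must, by
  emptiness, end directly above \<open>a\<close>.\<close>

lemma corner_left:
  assumes ab1: "lx b1 a" "ly a b1"
  shows "linked E a b (l1dist a b + 89/10 * k)"
proof -
  note bf = b1_facts
  have o: "0 \<le> X a - X b1" "0 \<le> Y b1 - Y a" "Y b1 - Y a \<le> k"
    using lx_X[OF ab1(1)] ly_Y[OF bf(3)] ly_Y[OF ab1(2)] k by auto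
  have Xbb1: "w + (X a - X b1) \<le> dist b b1" using coord_le_dist(1)[of b b1] by (simp add: w)
  have bb1: "dist b b1 \<le> w + k" using bf dist_le_l1dist[of a b] by simp
  then have Xk: "X a - X b1 \<le> k" using Xbb1 by simp
  interpret fl: frame V E "\<lambda>p. - X p" Y "conversep lx" ly by (rule frame_flip_x)
  show ?thesis
    using aV bf(1)
  proof (rule fl.linked_or_exit)
    show "conversep lx a b1" "ly a b1" using ab1 by auto
  next
    assume "linked E a b1 (25/4 * dist a b1)"
    from linked_trans[OF this bf(5)] show ?thesis
    proof (rule linked_mono)
      have "(X a - X b1)\<^sup>2 \<le> k\<^sup>2" "(Y a - Y b1)\<^sup>2 \<le> k\<^sup>2"
        using o Xk by (auto intro!: power_mono simp: power2_commute[of "Y a"])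
      \<comment> \<open>The factor \<open>1424/1000\<close> exceeds \<open>sqrt 2\<close>, and
        multiplied by \<open>25/4\<close> it gives exactly \<open>89/10\<close>.\<close>
      moreover have "(1424/1000 * k)\<^sup>2 = 31684/15625 * k\<^sup>2"
        by (simp add: power_mult_distrib power_divide)
      ultimately have "(dist a b1)\<^sup>2 \<le> (1424/1000 * k)\<^sup>2"
        using zero_le_power2[of k]
        unfolding dist_sq by linarith
      then have "dist a b1 \<le> 1424/1000 * k" by (rule power2_le_imp_le) (use bf in simp)
      then show "25/4 * dist a b1 + dist b b1 \<le> l1dist a b + 89/10 * k" using bb1 bf by simp
    qed
  next
    fix t t'
    assume t: "t \<in> span_box V (conversep lx) ly a b1" "t \<noteq> b1" "linked E a t (l1dist a t)"
      "nearest V E (conversep lx) ly t t'" "conversep lx t' b1" "ly b1 t'"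
    have tt': "lx t' t" "ly t t'" "t' \<in> V" "E t t'" using t by (auto simp: nearest_def)
    have tb1: "lx b1 t" "ly t b1" and ta: "t = a \<or> lx t a" using t by (auto simp: span_box_def)
    note tc = fl.box_coords[OF t(1)]
    have tb: "lx t b" using ta ab lx_trans by blast
    then have t'b: "lx t' b" using tt' lx_trans by blast
    have "ly b t'"
    proof (rule ccontr)
      assume "\<not> ly b t'"
      moreover have "t' \<noteq> b" using t'b by auto
      ultimately have "ly t' b" using not_ly_iff[of b t'] by auto
      then have "dist b t' < dist b b1" "dist b b1 \<le> dist b t'"
        using dist_less_SW[of t' b b1] t'b t nearest_le[OF b1 tt'(3)] by auto
      then show False by simp
    qed
    then have h: "hook V E ly (conversep lx) t t' b b1"
      using t b1 tb1 tb tc(5) bV by (simp add: hook_def nearest_swap)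
    interpret sw: frame V E Y "\<lambda>p. - X p" ly "conversep lx"
      by (rule fl.frame_swap_xy)
    note hl = sw.hook_linked[OF h] and hf = sw.hook_facts[OF h]
    have "3 * (dist t' b1)\<^sup>2 \<le> 4 * (X t - X b1)\<^sup>2" using hf(2) by (simp add: power2_commute)
    moreover have "(dist t b1)\<^sup>2 = (X t - X b1)\<^sup>2 + (Y b1 - Y t)\<^sup>2"
      by (simp add: dist_sq power2_commute)
    ultimately have D: "X t - X b1 \<le> Y b - Y t" "dist t b1 \<le> 70711/50000 * (Y b - Y t)"
      "dist t' b1 \<le> 1155/1000 * (X t - X b1)"
      using short_leg_bound[of "dist t b1" "X t - X b1" "Y b1 - Y t" "Y b - Y t" "dist t' b1"]
        hf(4) tc o k by auto
    have "dist t t' \<le> dist t b1" using t tb1 bf by (auto simp: nearest_def)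
    then have "linked E t t' (dist t b1)" using linked_edge[of E t t'] tt' by auto
    from linked_join[OF t(3) this hl order_refl]
    show ?thesis
    proof (rule linked_mono[OF linked_trans[OF _ bf(5)]])
      show "l1dist a t + dist t b1 + 25/4 * dist t' b1 + dist b b1 \<le> l1dist a b + 89/10 * k"
      proof -
        have "l1dist a t = X a - X t + (Y t - Y a)" using tc by (simp add: l1_XY)
        then show ?thesis using D tc(1-4) o Xk bb1 bf(8,9) k by argo
      qed
    qed
  next
    fix t t'
    assume t: "t \<in> span_box V (conversep lx) ly a b1" "t \<noteq> a" "linked E t b1 (l1dist t b1)"
      "nearest V E (conversep (conversep lx)) (conversep ly) t t'" and "conversep lx t' a" "ly a t'"
    then have t'a: "lx a t'" "ly a t'" by auto
    have tt': "lx t t'" "ly t' t" "t' \<in> V" "E t t'" using t by (auto simp: nearest_def)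
    have ta: "lx t a" "ly a t" and tb1: "t = b1 \<or> ly t b1" using t by (auto simp: span_box_def)
    note tc = fl.box_coords[OF t(1)]
    have tb: "ly t b" using tb1 bf ly_trans by blast
    then have t'b: "ly t' b" using tt' ly_trans by blast
    have "dist t t' \<le> dist t a" using t ta aV by (auto simp: nearest_def)
    then have "(dist t t')\<^sup>2 \<le> (dist t a)\<^sup>2" by (auto intro: power_mono)
    then have e: "((X a - X t) + (X t' - X a))\<^sup>2 + ((Y t - Y a) - (Y t' - Y a))\<^sup>2
        \<le> (X a - X t)\<^sup>2 + (Y t - Y a)\<^sup>2"
      by (simp add: dist_sq power2_commute)
    have o': "0 \<le> X t' - X a" "Y t' \<le> Y t" "0 \<le> Y t' - Y a"
      using lx_X[OF t'a(1)] ly_Y[OF tt'(2)] ly_Y[OF t'a(2)] by auto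
    have Y0: "0 < Y t' - Y a"
    proof (rule ccontr)
      assume "\<not> ?thesis"
      then have "Y t' = Y a" using o' by simp
      then have "((X a - X t) + (X t' - X a))\<^sup>2 \<le> (X a - X t)\<^sup>2" using e by simp
      then have "(X a - X t) + (X t' - X a) \<le> X a - X t"
        by (rule power2_le_imp_le) (use tc in simp)
      then have "t' = a" using o' \<open>Y t' = Y a\<close> by (intro eq_if_coords_eq) auto
      then show False using t'a by simp
    qed
    have X0: "X t' = X a"
    proof (rule ccontr)
      assume "X t' \<noteq> X a"
      then have c: "0 < X t' - X a" using o' by simp
      \<comment> \<open>By emptiness the alternative is that \<open>t'\<close> lies on or beyond the
        right side, which the inequality \<open>e\<close> rules out.\<close>
      have "Y t' = Y a + k"
      proof (rule ccontr)
        assume "Y t' \<noteq> Y a + k"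
        then have "Y t' < Y a + k" using o' tc o by simp
        then have kc: "k \<le> X t' - X a"
          using square tt' Y0 c by (auto simp: empty_square_def)
        have "k\<^sup>2 \<le> (X t' - X a)\<^sup>2" using kc bf by (intro power_mono) auto
        moreover have "(Y t - Y a)\<^sup>2 \<le> k\<^sup>2" using tc o by (intro power_mono) auto
        moreover have "0 \<le> (X a - X t) * (X t' - X a)" using tc o' by simp
        moreover have "(X a - X t)\<^sup>2 + (X t' - X a)\<^sup>2 + 2 * ((X a - X t) * (X t' - X a)) + (Y t - Y t')\<^sup>2
            \<le> (X a - X t)\<^sup>2 + (Y t - Y a)\<^sup>2"
          using e by (simp add: power2_eq_square algebra_simps)
        ultimately have z: "(Y t - Y t')\<^sup>2 \<le> 0" "k\<^sup>2 \<le> (Y t - Y a)\<^sup>2"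
          using zero_le_power2[of "Y t - Y t'"] by linarith+
        then have "k \<le> Y t - Y a" using tc by (auto intro: power2_le_imp_le)
        then show False using z \<open>Y t' < Y a + k\<close> by simp
      qed
      then have Yeq: "Y t = Y t'" "Y t = Y b" using o' tc o k by auto
      have "X t \<noteq> X b" using eq_if_coords_eq[of t b] Yeq tb by auto
      then have "X t < X b" using tc bf w by auto
      \<comment> \<open>All three points are at the same height, and the uniform tie-break carries
        \<open>ly t b\<close> over to \<open>ly t t'\<close>, against the direction of the
        edge.\<close>
      then have "ly t t'" using tie_Y[of t b t t'] Yeq tb tc c by auto
      then show False using tt' ly_asym by blast
    qed
    have t'nb: "t' \<noteq> b" using t'b by auto
    have Ytb: "Y t' \<le> Y b" using ly_Y[OF t'b] .
    have "dist a t' < dist a b"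
      by (rule dist_less_if_between) (use o' X0 Ytb t'nb bf w in auto)
    then have cg: "corner_good V E a t'" using IH aV tt' by blast
    have max: "max (X t' - X a) (Y t' - Y a) = Y t' - Y a" using X0 Y0 by simp
    have l: "linked E a t' (l1dist a t' + 89/10 * (Y t' - Y a))"
      using corner_goodD[OF cg t'a square] Ytb unfolding max k by auto
    \<comment> \<open>If \<open>w = 0\<close>, then \<open>a\<close>, \<open>t'\<close> and
      \<open>b\<close> share a vertical line, and the tie-break of \<open>a\<close> and
      \<open>b\<close> decides that of \<open>t'\<close> and \<open>b\<close>.\<close>
    have "lx t' b"
    proof (cases "w = 0")
      case True
      then have "Y t' \<noteq> Y b" using eq_if_coords_eq[of t' b] t'nb X0 w by auto
      then show ?thesis using tie_X[of a b t' b] True X0 w k bf ab Ytb by auto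
    next
      case False
      then show ?thesis using bf X0 w by (intro lx_if_less) auto
    qed
    then have "dist b b1 \<le> dist b t'" using nearest_le[OF b1 tt'(3)] t'b by auto
    then have bt': "dist b b1 \<le> w + (k - (Y t' - Y a))"
      using dist_le_l1dist[of b t'] Ytb X0 bf by (auto simp: l1_XY w k)
    have "linked E t' t (dist t t')"
      using linked_edge[of E t t'] tt' by (simp add: linked_commute)
    moreover have "linked E t b (l1dist t b1 + dist b b1)"
      using linked_trans[OF t(3) bf(5)] .
    ultimately show ?thesis
    proof (rule linked_join[OF l])
      have "dist t t' \<le> l1dist t t'" by (rule dist_le_l1dist)
      then show "l1dist a t' + 89/10 * (Y t' - Y a) + dist t t' + (l1dist t b1 + dist b b1)
          \<le> l1dist a b + 89/10 * k"
      proof -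
        have "l1dist a t' = Y t' - Y a" "l1dist t t' = X a - X t + (Y t - Y t')"
          "l1dist t b1 = X t - X b1 + (Y b1 - Y t)"
          using X0 Y0 o' tc by (simp_all add: l1_XY)
        then show ?thesis
          using \<open>dist t t' \<le> l1dist t t'\<close> bt' Xbb1 Y0 o o'(2,3) bf(7-9) Ytb k by argo
      qed
    qed
  qed
qed

lemma corner_step: "linked E a b (l1dist a b + 89/10 * k)"
proof -
  note bf = b1_facts
  consider "b1 = a" | "lx a b1" "ly a b1" | "lx a b1" "ly b1 a" | "lx b1 a" "ly a b1" | "lx b1 a" "ly b1 a"
    using lx_total[of a b1] ly_total[of a b1] by blast
  then show ?thesis
  proof cases
    case 1
    then show ?thesis
      using linked_mono[OF bf(5)] bf(6,8) dist_le_l1dist[of a b] by (auto simp: dist_commute)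
  next
    case 5
    then have "dist b a < dist b b1" using dist_less_SW[of a b b1] ab by auto
    then show ?thesis using bf by (simp add: dist_commute)
  qed (fact corner_inside corner_below corner_left)+
qed

end

end

lemma corner_good_all:
  assumes "frame V E X Y lx ly" "p \<in> V" "q \<in> V"
  shows "corner_good V E p q"
  using frame.finV[OF assms(1)] assms(2,3)
proof (induction rule: pair_dist_induct)
  case (less p q)
  have step: "linked E p q (l1dist p q + 89/10 * m)"
    if fr: "frame V E X Y lx ly" and pq: "lx p q" "ly p q" and m: "m = max (X q - X p) (Y q - Y p)"
      and sq: "empty_square V X Y (X p) (Y p) m" and le: "X q - X p \<le> Y q - Y p" for X Y lx ly m
  proof -
    interpret frame V E X Y lx ly by fact
    obtain b1 where b1: "nearest V E (conversep lx) (conversep ly) q b1"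
      using nearest_SW_ex[of q p] less pq by auto
    have "m = Y q - Y p" using m le by simp
    then show ?thesis
      using corner_step[OF less(1,2) pq refl refl le _ less(3) b1] sq by simp
  qed
  show ?case
    unfolding corner_good_def
  proof (intro allI impI)
    fix X Y lx ly m
    assume fr: "frame V E X Y lx ly" and pq: "lx p q" "ly p q" and m: "m = max (X q - X p) (Y q - Y p)"
      and sq: "empty_square V X Y (X p) (Y p) m"
    show "linked E p q (l1dist p q + 89/10 * m)"
    proof (cases "X q - X p \<le> Y q - Y p")
      case True
      then show ?thesis using step fr pq m sq by blast
    next
      case False
      then show ?thesis
        using step[OF frame_swap[OF fr] pq(2,1), of m] m sq
        by (simp add: max.commute empty_square_swap[of V Y])
    qed
  qed
qed

section \<open>From corners to arbitrary positions on an empty square\<close>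

context frame
begin

text \<open>The tie-break may order a vertical pair against the frame. After reversing the second
  axis, \<open>b\<close> precedes \<open>a\<close> in both orders and serves as the corner.\<close>

lemma corner_linked_vertical:
  assumes "a \<in> V" "b \<in> V" "lx b a" "ly a b" "X a = X b"
    and sq: "empty_square V X Y (X a) (Y a) (Y b - Y a)"
  shows "linked E a b (l1dist a b + 89/10 * (Y b - Y a))"
proof -
  interpret fl: frame V E X "\<lambda>p. - Y p" lx "conversep ly" by (rule frame_flip_y)
  have "empty_square V X (\<lambda>p. - Y p) (X b) (- Y b) (Y b - Y a)"
    using sq assms(5) empty_square_flip_y[of V X Y "X a" "Y a" "Y b - Y a"] by simp
  then have "linked E b a (l1dist b a + 89/10 * max (X a - X b) (- Y a - - Y b))"
    using assms ly_Y[OF assms(4)]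
    by (intro fl.corner_goodD[where m = "Y b - Y a"] corner_good_all[OF frame_axioms]) auto
  then show ?thesis
    using assms ly_Y[OF assms(4)] by (simp add: linked_commute l1dist_commute)
qed

lemma corner_linked:
  assumes V: "a \<in> V" "b \<in> V" and "a \<noteq> b" and o: "X a \<le> X b" "Y a \<le> Y b"
    and sq: "empty_square V X Y (X a) (Y a) (max (X b - X a) (Y b - Y a))"
  shows "linked E a b (l1dist a b + 89/10 * max (X b - X a) (Y b - Y a))"
proof (cases "lx a b")
  case True
  show ?thesis
  proof (cases "ly a b")
    case True
    then show ?thesis
      using corner_goodD[OF corner_good_all[OF frame_axioms V] \<open>lx a b\<close> True sq] by simp
  next
    case False
    interpret sw: frame V E Y X ly lx by (rule frame_swap_xy)
    have "ly b a" using False not_ly_iff[of a b] \<open>a \<noteq> b\<close> by auto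
    then have "Y a = Y b" using ly_Y[of b a] o by simp
    then show ?thesis
      using sw.corner_linked_vertical[OF V \<open>ly b a\<close> \<open>lx a b\<close>] sq o empty_square_swap[of V X]
      by simp
  qed
next
  case False
  then have ba: "lx b a" using not_lx_iff[of a b] \<open>a \<noteq> b\<close> by auto
  then have eq: "X a = X b" using lx_X[of b a] o by simp
  then have "Y a \<noteq> Y b" using eq_if_coords_eq[of a b] \<open>a \<noteq> b\<close> by auto
  then have "ly a b" using o by (intro ly_if_less) simp
  then show ?thesis
    using corner_linked_vertical[OF V ba _ eq] sq o eq by simp
qed

text \<open>Shrink the square to the larger coordinate difference: if this is horizontal,
  \<open>a\<close> becomes a corner; if vertical, \<open>g\<close> does.\<close>

lemma adjacent_sides_linked:
  assumes V: "a \<in> V" "g \<in> V" and "a \<noteq> g" and o: "X a \<le> X g" "Y a \<le> Y g"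
    and h: "X g - X a \<le> h" "Y g - Y a \<le> h" and sq: "empty_square V X Y (X g - h) (Y a) h"
  shows "linked E a g (l1dist a g + 89/10 * h)"
proof -
  have "linked E a g (l1dist a g + 89/10 * max (X g - X a) (Y g - Y a))"
  proof (cases "Y g - Y a \<le> X g - X a")
    case True
    then have max: "max (X g - X a) (Y g - Y a) = X g - X a" by simp
    have "empty_square V X Y (X a) (Y a) (X g - X a)"
      by (rule empty_square_mono[OF sq]) (use h in auto)
    then show ?thesis using corner_linked[OF V \<open>a \<noteq> g\<close> o] unfolding max by blast
  next
    case False
    interpret rot: frame V E "\<lambda>p. - X p" "\<lambda>p. - Y p" "conversep lx" "conversep ly"
      by (intro frame_flipX frame_flip_y)
    have max: "max (- X a - - X g) (- Y a - - Y g) = Y g - Y a" using False by simp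
    have "empty_square V X Y (X g - (Y g - Y a)) (Y a) (Y g - Y a)"
      by (rule empty_square_mono[OF sq]) (use h in auto)
    then have "empty_square V (\<lambda>p. - X p) (\<lambda>p. - Y p) (- X g) (- Y g) (Y g - Y a)"
      using empty_square_flip_x[of V X Y] empty_square_flip_y[of V "\<lambda>p. - X p" Y] by simp
    then have "linked E g a (l1dist g a + 89/10 * (Y g - Y a))"
      using rot.corner_linked[OF V(2,1)] o \<open>a \<noteq> g\<close> unfolding max by simp
    then show ?thesis using False by (simp add: linked_commute l1dist_commute)
  qed
  then show ?thesis by (rule linked_mono) (use h in simp)
qed

text \<open>Slide the empty square to the right until its left side contains \<open>a\<close> or its right side meets
  a point \<open>g\<close>; in the latter case go through \<open>g\<close>.\<close>
lemma opposite_sides_linked: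
  assumes V: "a \<in> V" "b \<in> V" and h: "h = Y b - Y a" "0 < h" and o: "X a \<le> X b"
    and s: "s \<le> X a" "X b \<le> s + h" and sq: "empty_square V X Y s (Y a) h"
  shows "linked E a b ((11 + 7 * sqrt 2) * dist a b)"
proof -
  have hd: "h \<le> dist a b" using coord_le_dist(2)[of a b] h by simp
  have "1.41421 \<le> sqrt 2" by (rule real_le_rsqrt) (simp add: power2_eq_square)
  \<comment> \<open>The detour through \<open>g\<close> costs \<open>3 * h\<close> in L1 distance
    plus twice \<open>89/10 * h\<close>, which is \<open>104/5 * h\<close>; the direct case costs
    less.\<close>
  then have "(104/5) * dist a b \<le> (11 + 7 * sqrt 2) * dist a b"
    by (intro mult_right_mono) auto
  then have fin: ?thesis if "linked E a b (104/5 * h)"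
    using that hd by (elim linked_mono) simp
  \<comment> \<open>The points met by the right side while the left side moves from \<open>s\<close>
    to \<open>X a\<close>; the leftmost of them stops the slide.\<close>
  define G where "G = {g \<in> V. Y a < Y g \<and> Y g < Y b \<and> s + h \<le> X g \<and> X g < X a + h}"
  show ?thesis
  proof (cases "G = {}")
    case True
    have "empty_square V X Y (X a) (Y a) h"
      unfolding empty_square_def
    proof (intro ballI notI)
      fix v assume v: "v \<in> V" "X a < X v \<and> X v < X a + h \<and> Y a < Y v \<and> Y v < Y a + h"
      have "X v < s + h"
      proof (rule ccontr)
        assume "\<not> X v < s + h"
        then have "v \<in> G" using v h by (simp add: G_def)
        then show False using True by simp
      qed
      then show False using sq v s by (auto simp: empty_square_def)
    qed
    moreover have max: "max (X b - X a) (Y b - Y a) = h" using s h by simp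
    moreover have "a \<noteq> b" using h by auto
    ultimately have "linked E a b (l1dist a b + 89/10 * h)"
      using corner_linked[OF V _ o] h unfolding max by auto
    moreover have "l1dist a b \<le> 2 * h" using s h o by (simp add: l1_XY)
    ultimately show ?thesis using h(2) by (intro fin) (auto elim!: linked_mono)
  next
    case False
    have finG: "finite G" unfolding G_def using finV by auto
    obtain g where g: "g \<in> G" "\<And>g'. g' \<in> G \<Longrightarrow> X g \<le> X g'"
      using ex_min_if_finite[of "X ` G"] finG False by (force simp: not_less)
    then have gV: "g \<in> V" and gc: "Y a < Y g" "Y g < Y b" "s + h \<le> X g" "X g < X a + h"
      by (auto simp: G_def)
    have sq': "empty_square V X Y (X g - h) (Y a) h"
      unfolding empty_square_def
    proof (intro ballI notI)
      fix v assume v: "v \<in> V" "X g - h < X v \<and> X v < X g - h + h \<and> Y a < Y v \<and> Y v < Y a + h"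
      show False
      proof (cases "X v < s + h")
        case True
        then show ?thesis using sq v gc by (auto simp: empty_square_def)
      next
        case False
        then have "v \<in> G" using v gc h by (auto simp: G_def)
        then show ?thesis using g(2)[of v] v by simp
      qed
    qed
    have "linked E a g (l1dist a g + 89/10 * h)"
      using V gV gc o s h sq' by (intro adjacent_sides_linked) auto
    moreover have "linked E g b (l1dist g b + 89/10 * h)"
    proof -
      interpret fl: frame V E X "\<lambda>p. - Y p" lx "conversep ly" by (rule frame_flip_y)
      have "empty_square V X (\<lambda>p. - Y p) (X g - h) (- Y b) h"
        using sq' empty_square_flip_y[of V X Y "X g - h" "Y a" h] h by simp
      then have "linked E b g (l1dist b g + 89/10 * h)"
        using V gV gc s o h by (intro fl.adjacent_sides_linked) auto
      then show ?thesis by (simp add: linked_commute l1dist_commute)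
    qed
    ultimately have "linked E a b (l1dist a g + 89/10 * h + (l1dist g b + 89/10 * h))"
      by (rule linked_trans)
    moreover have "l1dist a g + l1dist g b \<le> 3 * h" using gc s h o by (simp add: l1_XY)
    ultimately show ?thesis using h(2) by (intro fin) (auto elim!: linked_mono)
  qed
qed

text \<open>Shrinking the side to \<open>h\<close> places \<open>a\<close> and \<open>b\<close> on
  opposite horizontal sides. The value \<open>s\<close> is the leftmost left side that stays within
  the old square and keeps \<open>b\<close> covered.\<close>

lemma square_linked:
  assumes V: "a \<in> V" "b \<in> V" "a \<noteq> b" and o: "X a \<le> X b" "Y a \<le> Y b" "X b - X a \<le> Y b - Y a"
    and a: "\<bar>X a - x\<bar> \<le> r" "\<bar>Y a - y\<bar> \<le> r" and b: "\<bar>X b - x\<bar> \<le> r" "\<bar>Y b - y\<bar> \<le> r"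
    and sq: "empty_square V X Y (x - r) (y - r) (2 * r)"
  shows "linked E a b ((11 + 7 * sqrt 2) * dist a b)"
proof -
  define h where "h = Y b - Y a"
  define s where "s = max (x - r) (X b - h)"
  have "h \<noteq> 0" using eq_if_coords_eq[of a b] V o by (auto simp: h_def)
  then have "0 < h" using o by (simp add: h_def)
  moreover have "s \<le> X a" "X b \<le> s + h" using o a b by (auto simp: s_def h_def)
  moreover have "empty_square V X Y s (Y a) h"
    by (rule empty_square_mono[OF sq]) (use o a b in \<open>auto simp: s_def h_def\<close>)
  ultimately show ?thesis using opposite_sides_linked[OF V(1,2) h_def] o by blast
qed

lemma square_linked_any:
  assumes V: "a \<in> V" "b \<in> V" "a \<noteq> b"
    and a: "\<bar>X a - x\<bar> \<le> r" "\<bar>Y a - y\<bar> \<le> r" and b: "\<bar>X b - x\<bar> \<le> r" "\<bar>Y b - y\<bar> \<le> r"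
    and sq: "empty_square V X Y (x - r) (y - r) (2 * r)"
  shows "linked E a b ((11 + 7 * sqrt 2) * dist a b)"
proof -
  have ordered: "linked E a b ((11 + 7 * sqrt 2) * dist a b)"
    if fr: "frame V E X Y lx ly" and o: "X a \<le> X b" "Y a \<le> Y b"
      and a: "\<bar>X a - x\<bar> \<le> r" "\<bar>Y a - y\<bar> \<le> r" and b: "\<bar>X b - x\<bar> \<le> r" "\<bar>Y b - y\<bar> \<le> r"
      and sq: "empty_square V X Y (x - r) (y - r) (2 * r)"
    for X Y lx ly x y
  proof (cases "X b - X a \<le> Y b - Y a")
    case True
    then show ?thesis using frame.square_linked[OF fr V o _ a b sq] by simp
  next
    case False
    then show ?thesis
      using frame.square_linked[OF frame_swap[OF fr] V o(2,1) _ a(2,1) b(2,1)] sq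
        empty_square_swap[of V X] by simp
  qed
  have flip: "\<bar>- u - - v\<bar> \<le> r" if "\<bar>u - v\<bar> \<le> r" for u v :: real
    using that by simp
  have neg: "- (u - r) - 2 * r = - u - r" for u :: real by simp
  have sqx: "empty_square V (\<lambda>p. - X p) Y' (- x - r) y' (2 * r)"
    if "empty_square V X Y' (x - r) y' (2 * r)" for Y' y'
    using that empty_square_flip_x[of V X Y' "x - r" y' "2 * r", unfolded neg] by blast
  have sqy: "empty_square V X' (\<lambda>p. - Y p) x' (- y - r) (2 * r)"
    if "empty_square V X' Y x' (y - r) (2 * r)" for X' x'
    using that empty_square_flip_y[of V X' Y x' "y - r" "2 * r", unfolded neg] by blast
  consider "X a \<le> X b" "Y a \<le> Y b" | "X b \<le> X a" "Y a \<le> Y b"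
    | "X a \<le> X b" "Y b \<le> Y a" | "X b \<le> X a" "Y b \<le> Y a" by linarith
  then show ?thesis
  proof cases
    case 1
    then show ?thesis using ordered[OF frame_axioms _ _ a b sq] by simp
  next
    case 2
    then show ?thesis
      using ordered[OF frame_flip_x _ _ flip[OF a(1)] a(2) flip[OF b(1)] b(2) sqx[OF sq]] by simp
  next
    case 3
    then show ?thesis
      using ordered[OF frame_flip_y _ _ a(1) flip[OF a(2)] b(1) flip[OF b(2)] sqy[OF sq]] by simp
  next
    case 4
    then show ?thesis
      using ordered[OF frame_flipX[OF frame_flip_y] _ _ flip[OF a(1)] flip[OF a(2)]
          flip[OF b(1)] flip[OF b(2)] sqx[OF sqy[OF sq]]] by simp
  qed
qed

end

section \<open>The Yao graph as a frame\<close>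

text \<open>Ordering points by coordinate and breaking ties in this way amounts to rotating the axes by an
  infinitesimal angle; the half-open quadrants then become open ones.\<close>
definition before_x :: "point \<Rightarrow> point \<Rightarrow> bool" where
  "before_x p q \<longleftrightarrow> fst p < fst q \<or> fst p = fst q \<and> snd q < snd p"

definition before_y :: "point \<Rightarrow> point \<Rightarrow> bool" where
  "before_y p q \<longleftrightarrow> snd p < snd q \<or> snd p = snd q \<and> fst p < fst q"

lemma quadrant_iff:
  "v \<in> quadrant 1 u \<longleftrightarrow> before_x u v \<and> before_y u v"
  "v \<in> quadrant 2 u \<longleftrightarrow> before_x v u \<and> before_y u v"
  "v \<in> quadrant 3 u \<longleftrightarrow> before_x v u \<and> before_y v u"
  "v \<in> quadrant 4 u \<longleftrightarrow> before_x u v \<and> before_y v u"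
  by (auto simp: quadrant_def before_x_def before_y_def)

lemma yao_nearest:
  assumes f: "yao_choice V f" and i: "i \<in> {1..4}" and u: "u \<in> V" and w: "w \<in> V" "w \<noteq> u" "w \<in> quadrant i u"
    and l: "\<And>v. v \<in> quadrant i u \<longleftrightarrow> l1 u v \<and> l2 u v" and irrefl: "\<not> l1 u u"
  shows "nearest V (yao4 V f) l1 l2 u (f u i)"
proof -
  have *: "f u i \<in> V - {u}" "f u i \<in> quadrant i u"
    "\<forall>w\<in>V - {u}. w \<in> quadrant i u \<longrightarrow> dist u (f u i) \<le> dist u w"
    using assms unfolding yao_choice_def by blast+
  have "yao4 V f u (f u i)"
    using i u w unfolding yao4_def yao4_dir_def by blast
  then show ?thesis using * l irrefl unfolding nearest_def by blast
qed

lemma frame_yao4: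
  assumes "finite V" and f: "yao_choice V f"
  shows "frame V (yao4 V f) fst snd before_x before_y"
proof
  show "\<exists>v. nearest V (yao4 V f) l1 l2 u v"
    if l: "l1 \<in> {before_x, conversep before_x}" "l2 \<in> {before_y, conversep before_y}"
      and uw: "u \<in> V" "w \<in> V" "l1 u w" "l2 u w" for l1 l2 u w
  proof -
    have irrefl: "\<not> l1 u u" using l by (auto simp: before_x_def)
    then have "w \<noteq> u" using uw by auto
    obtain i :: nat where i: "i \<in> {1..4}" and quadrant: "\<And>v. v \<in> quadrant i u \<longleftrightarrow> l1 u v \<and> l2 u v"
    proof -
      consider "l1 = before_x" "l2 = before_y" | "l1 = conversep before_x" "l2 = before_y"
        | "l1 = conversep before_x" "l2 = conversep before_y" | "l1 = before_x" "l2 = conversep before_y"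
        using l by auto
      then show thesis
        by cases (use that[of 1] that[of 2] that[of 3] that[of 4] quadrant_iff in simp_all)
    qed
    have "nearest V (yao4 V f) l1 l2 u (f u i)"
    proof (rule yao_nearest[OF f i uw(1,2) \<open>w \<noteq> u\<close>])
      show "w \<in> quadrant i u" using quadrant uw by blast
    qed (fact quadrant irrefl)+
    then show ?thesis by blast
  qed
qed (use assms(1) in \<open>auto simp: yao4_def dist_prod_def dist_real_def l1dist_def before_x_def before_y_def
      prod_eq_iff\<close>)

theorem theorem3:
  fixes V :: "point set" and f :: "point \<Rightarrow> nat \<Rightarrow> point" and a b :: point
  assumes "finite V"
    and "yao_choice V f"
    and "del_inf V a b"
  shows "d_yao4 V f a b \<le> ereal ((11 + 7 * sqrt 2) * dist a b)"
proof -
  interpret frame V "yao4 V f" fst snd before_x before_y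
    by (rule frame_yao4[OF assms(1,2)])
  obtain c r where ab: "a \<in> V" "b \<in> V" "a \<noteq> b" and c: "linf c a = r" "linf c b = r"
    and empty: "\<forall>v\<in>V. \<not> linf c v < r"
    using assms(3) unfolding del_inf_def by blast
  have "empty_square V fst snd (fst c - r) (snd c - r) (2 * r)"
    using empty unfolding empty_square_def linf_def by force
  then have "linked (yao4 V f) a b ((11 + 7 * sqrt 2) * dist a b)"
    using ab c by (intro square_linked_any[of a b "fst c" r "snd c"]) (auto simp: linf_def)
  then obtain ps where "is_walk (yao4 V f) ps a b" "walk_length ps \<le> (11 + 7 * sqrt 2) * dist a b"
    using linked_walk by blast
  then show ?thesis
    unfolding d_yao4_def by (intro INF_lower2[of ps]) auto
qed

end
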